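(* There is a one-parameter family of groups generated by elements $A$ and $B$ of $\mathrm{SU}(2,1)$ such that $A$, $B$, $AB$, $AB^{-1}$, $AB^2$, $A^2B$ and $[A,B]=ABA^{-1}B^{-1}$ are all parabolic. (That is, there are a non-degenerate real interval $I$ and continuous maps $t\mapsto A(t)$, $t\mapsto B(t)$ from $I$ to $\mathrm{SU}(2,1)$ such that for every $t\in I$ the pair $(A(t),B(t))$ has the stated property, and such that for $t\neq t'$ the pairs $(A(t),B(t))$ and $(A(t'),B(t'))$ are not simultaneously conjugate in $\mathrm{SU}(2,1)$.)
   Context: $\mathrm{SU}(2,1)$ is the group of determinant-one linear maps of $\mathbb{C}^3$ preserving a Hermitian form $\langle\cdot,\cdot\rangle$ of signature $(2,1)$. Complex hyperbolic space $\mathbf{H}^2_{\mathbb{C}}$ is the set of complex lines spanned by negative vectors, and its boundary $\partial\mathbf{H}^2_{\mathbb{C}}$ is the set of complex lines spanned by non-zero null vectors. An element of $\mathrm{SU}(2,1)$ is parabolic if its action on $\mathbf{H}^2_{\mathbb{C}}\cup\partial\mathbf{H}^2_{\mathbb{C}}$ has exactly one fixed point and this point lies on $\partial\mathbf{H}^2_{\mathbb{C}}$ (equivalently, it fixes a boundary point, all its eigenvalues have modulus one, and it is not diagonalizable). *)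

theory Defs
  imports "HOL-Analysis.Analysis"
begin

definition herm :: "complex^3^3 \<Rightarrow> complex^3 \<Rightarrow> complex^3 \<Rightarrow> complex" where
  "herm H z w = (\<Sum>i\<in>UNIV. \<Sum>j\<in>UNIV. cnj (w $ i) * H $ i $ j * z $ j)"

text \<open>Signature counted on an orthogonal basis, as in Sylvester's law of inertia.
  Pairwise orthogonal vectors with non-zero norms are automatically linearly
  independent, so \<open>u\<close>, \<open>v\<close>, \<open>w\<close> below do form a basis. When \<open>H\<close> is Hermitian,
  \<open>herm H z z\<close> is real, so here and below \<open>Re\<close> loses no information.\<close>

definition hermitian_signature_2_1 :: "complex^3^3 \<Rightarrow> bool" where
  "hermitian_signature_2_1 H \<longleftrightarrow>
     (\<forall>i j. H $ i $ j = cnj (H $ j $ i)) \<and>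
     (\<exists>u v w. herm H u v = 0 \<and> herm H u w = 0 \<and> herm H v w = 0 \<and>
        Re (herm H u u) > 0 \<and> Re (herm H v v) > 0 \<and> Re (herm H w w) < 0)"

definition SU :: "complex^3^3 \<Rightarrow> (complex^3^3) set" where
  "SU H = {A. det A = 1 \<and> (\<forall>z w. herm H (A *v z) (A *v w) = herm H z w)}"

text \<open>Points are complex lines, represented as one-dimensional subspaces;
  \<open>vec.span\<close> is the span over the complex scalars (whereas \<open>span\<close> would be
  the real span).\<close>

definition complex_hyperbolic_plane :: "complex^3^3 \<Rightarrow> (complex^3) set set" where
  "complex_hyperbolic_plane H = {vec.span {v} | v. Re (herm H v v) < 0}"

definition complex_hyperbolic_boundary :: "complex^3^3 \<Rightarrow> (complex^3) set set" where
  "complex_hyperbolic_boundary H = {vec.span {v} | v. v \<noteq> 0 \<and> herm H v v = 0}"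

definition fixed_points :: "complex^3^3 \<Rightarrow> complex^3^3 \<Rightarrow> (complex^3) set set" where
  "fixed_points H A =
     {L \<in> complex_hyperbolic_plane H \<union> complex_hyperbolic_boundary H. (\<lambda>z. A *v z) ` L = L}"

definition parabolic :: "complex^3^3 \<Rightarrow> complex^3^3 \<Rightarrow> bool" where
  "parabolic H A \<longleftrightarrow>
     A \<in> SU H \<and> (\<exists>L \<in> complex_hyperbolic_boundary H. fixed_points H A = {L})"

definition simultaneously_conjugate ::
    "complex^3^3 \<Rightarrow> complex^3^3 \<Rightarrow> complex^3^3 \<Rightarrow> complex^3^3 \<Rightarrow> complex^3^3 \<Rightarrow> bool" where
  "simultaneously_conjugate H A B A' B' \<longleftrightarrow>
     (\<exists>C \<in> SU H. C ** A ** matrix_inv C = A' \<and> C ** B ** matrix_inv C = B')"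

end

theory Submission
  imports Defs
begin

text \<open>The groups are subgroups of index at most three in groups generated by two elements \<open>S\<close>, \<open>T\<close> of order
three: put \<open>A = ST\<close> and \<open>B = TS\<close>. Because \<open>S\<^sup>3 = T\<^sup>3 = 1\<close>, the words \<open>A\<close>, \<open>B\<close>, \<open>AB\<close> are
conjugate to \<open>ST\<close> or its inverse, the words \<open>AB\<^sup>-\<^sup>1\<close>, \<open>AB\<^sup>2\<close>, \<open>A\<^sup>2B\<close> are conjugate to the commutator
\<open>[S,T]\<close> or its inverse, and \<open>[A,B] = (ST\<^sup>-\<^sup>1)\<^sup>3\<close> (lemma \<open>parabolic_words\<close>). So only \<open>ST\<close>,
\<open>ST\<^sup>-\<^sup>1\<close> and \<open>[S,T]\<close> have to be controlled.

Pairs of regular elements of order three depend, up to conjugation, on four real parameters;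
the complex numbers \<open>z = tr ST\<close> and \<open>w = tr ST\<^sup>-\<^sup>1\<close> serve as local coordinates. An
element of \<open>SU(2,1)\<close> has a repeated eigenvalue of modulus one iff its trace lies on the deltoid \<open>2l + l\<^sup>-\<^sup>2\<close>, \<open>|l| = 1\<close>. The three conditions
that \<open>z\<close>, \<open>w\<close> and \<open>c = tr [S,T]\<close> lie on the deltoid leave a curve of solutions. It can be written down:
on the deltoid \<open>Re z\<^sup>3\<close> is a polynomial in \<open>|z|\<^sup>2\<close>, and the expressions for \<open>Re c\<close> and \<open>|c|\<^sup>2\<close> in terms
of \<open>z\<close> and \<open>w\<close> then become
\<open>|z|\<^sup>2 + |w|\<^sup>2 = 2 Re c + 3\<close> and \<open>|z|\<^sup>2|w|\<^sup>2 = 27/2 + 2 (Im c)\<^sup>2\<close>. The parameter \<open>x\<close> is the argument of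
the repeated eigenvalue of \<open>[S,T]\<close>, so \<open>c = 2 e\<^sup>i\<^sup>x + e\<^sup>-\<^sup>2\<^sup>i\<^sup>x\<close>, and \<open>x\<close> runs through a small interval starting
at \<open>0\<close>. Distinct \<open>x\<close> give distinct traces \<open>c\<close> of \<open>AB\<^sup>2\<close>, hence pairs that are not simultaneously
conjugate.

The matrices are explicit in an orthonormal basis of eigenvectors of \<open>S\<close>, where the diagonal of \<open>T\<close>
is the inverse discrete Fourier transform of the traces (\<open>order_three_pair\<close>). That the
repeated eigenvalue comes with a Jordan block is visible on diagonals: a diagonalizable \<open>X\<close> with
eigenvalues \<open>l, l, l\<^sup>-\<^sup>2\<close> has its diagonal entries on a real line, whereas the diagonal entries
of \<open>ST\<close>, \<open>ST\<^sup>-\<^sup>1\<close> and \<open>[S,T]\<close> are the vertices of equilateral triangles with circumradii \<open>|w|/3\<close>, \<open>|z|/3\<close> and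
\<open>|zw|/3\<close> (\<open>Jordan_block_if_equilateral_diagonal\<close>). A Jordan block at an eigenvalue of
modulus one forces a unique fixed point, which lies on the boundary (\<open>parabolic_if_Jordan_block\<close>).
What remains is that the Hermitian form preserved by \<open>S\<close> and \<open>T\<close> has signature \<open>(2,1)\<close>, an open
condition, which is checked at \<open>x = 0\<close> (\<open>admissible_0\<close>).\<close>

section \<open>Isometries between Hermitian forms\<close>

lemma herm_add_left: "herm H (x + y) w = herm H x w + herm H y w"
  by (simp add: herm_def algebra_simps sum.distrib)

lemma herm_add_right: "herm H z (x + y) = herm H z x + herm H z y"
  by (simp add: herm_def algebra_simps sum.distrib)

lemma herm_scale_left: "herm H (c *s x) w = c * herm H x w"
  by (simp add: herm_def sum_distrib_left mult_ac)

lemma herm_scale_right: "herm H z (c *s x) = cnj c * herm H z x"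
  by (simp add: herm_def sum_distrib_left mult_ac)

lemmas herm_linear = herm_add_left herm_add_right herm_scale_left herm_scale_right

lemma image_line: "(\<lambda>z. U *v z) ` vec.span {v} = vec.span {U *v v :: complex^3}"
  by (auto simp: vec.span_singleton image_iff vector_scalar_commute)

definition isometric_inverses ::
    "complex^3^3 \<Rightarrow> complex^3^3 \<Rightarrow> complex^3^3 \<Rightarrow> complex^3^3 \<Rightarrow> bool" where
  "isometric_inverses K H U V \<longleftrightarrow> U ** V = mat 1 \<and> V ** U = mat 1 \<and>
     (\<forall>x y. herm H (U *v x) (U *v y) = herm K x y)"

lemma isometric_inverses_sym:
  assumes "isometric_inverses K H U V"
  shows "isometric_inverses H K V U"
proof -
  have "herm K (V *v x) (V *v y) = herm H x y" for x y
  proof -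
    have "herm K (V *v x) (V *v y) = herm H (U *v (V *v x)) (U *v (V *v y))"
      using assms by (simp add: isometric_inverses_def)
    also have "\<dots> = herm H x y"
      using assms by (simp add: isometric_inverses_def matrix_vector_mul_assoc)
    finally show ?thesis .
  qed
  then show ?thesis using assms by (simp add: isometric_inverses_def)
qed

lemma fixed_points_transport_subset:
  assumes "isometric_inverses K H U V" "L \<in> fixed_points K X"
  shows "(\<lambda>z. U *v z) ` L \<in> fixed_points H (U ** X ** V)"
proof -
  have UV: "U ** V = mat 1" and VU: "V ** U = mat 1"
    and iso: "\<And>x y. herm H (U *v x) (U *v y) = herm K x y"
    using assms(1) by (auto simp: isometric_inverses_def)
  have nz: "U *v v \<noteq> 0" if "v \<noteq> 0" for v
  proof
    assume "U *v v = 0"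
    then have "V *v (U *v v) = 0" by simp
    then show False using that VU by (simp add: matrix_vector_mul_assoc)
  qed
  have "(\<lambda>z. (U ** X ** V) *v z) ` (\<lambda>z. U *v z) ` L = (\<lambda>z. U *v z) ` (\<lambda>z. X *v z) ` L"
    by (simp add: image_image matrix_vector_mul_assoc matrix_mul_assoc[symmetric] VU)
  moreover have "(\<lambda>z. U *v z) ` L \<in> complex_hyperbolic_plane H \<union> complex_hyperbolic_boundary H"
  proof -
    have "L \<in> complex_hyperbolic_plane K \<union> complex_hyperbolic_boundary K"
      using assms(2) by (simp add: fixed_points_def)
    then obtain v where "L = vec.span {v}" "Re (herm K v v) < 0 \<or> v \<noteq> 0 \<and> herm K v v = 0"
      by (auto simp: complex_hyperbolic_plane_def complex_hyperbolic_boundary_def)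
    then show ?thesis
      using nz iso unfolding complex_hyperbolic_plane_def complex_hyperbolic_boundary_def
      by (simp add: image_line) metis
  qed
  ultimately show ?thesis using assms(2) by (simp add: fixed_points_def)
qed

lemma SU_transport:
  assumes "isometric_inverses K H U V" "X \<in> SU K"
  shows "U ** X ** V \<in> SU H"
proof -
  have "det U * det V = 1"
    using assms(1) unfolding isometric_inverses_def by (metis det_I det_mul)
  then have "det (U ** X ** V) = 1"
    using assms(2) by (simp add: SU_def det_mul mult.commute mult.left_commute)
  moreover have "herm H ((U ** X ** V) *v x) ((U ** X ** V) *v y) = herm H x y" for x y
    using assms isometric_inverses_sym[OF assms(1)]
    by (simp add: isometric_inverses_def SU_def matrix_vector_mul_assoc[symmetric])
  ultimately show ?thesis by (simp add: SU_def)
qed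

text \<open>An isometry maps fixed points to fixed points bijectively. With \<open>K = H\<close> this is conjugation invariance;
with \<open>K \<noteq> H\<close> it reduces everything to one diagonal form.\<close>
lemma parabolic_transport:
  assumes iso: "isometric_inverses K H U V" and par: "parabolic K X"
  shows "parabolic H (U ** X ** V)"
proof -
  have UV: "U ** V = mat 1" and VU: "V ** U = mat 1"
    using iso by (auto simp: isometric_inverses_def)
  obtain L where L: "L \<in> complex_hyperbolic_boundary K" "fixed_points K X = {L}"
    using par by (auto simp: parabolic_def)
  let ?f = "\<lambda>L. (\<lambda>z. U *v z) ` L" and ?g = "\<lambda>L. (\<lambda>z. V *v z) ` L"
  have "?f L \<in> fixed_points H (U ** X ** V)"
    using fixed_points_transport_subset[OF iso] L by blast
  moreover have "M = ?f L" if "M \<in> fixed_points H (U ** X ** V)" for M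
  proof -
    have "?g M \<in> fixed_points K (V ** (U ** X ** V) ** U)"
      using fixed_points_transport_subset[OF isometric_inverses_sym[OF iso] that] .
    also have "V ** (U ** X ** V) ** U = (V ** U) ** X ** (V ** U)"
      by (simp only: matrix_mul_assoc)
    also have "\<dots> = X"
      by (simp only: VU matrix_mul_lid matrix_mul_rid)
    finally have "?g M = L" by (simp add: L(2))
    moreover have "?f (?g M) = M"
      by (simp add: image_image matrix_vector_mul_assoc UV)
    ultimately show ?thesis by simp
  qed
  ultimately have "fixed_points H (U ** X ** V) = {?f L}" by blast
  moreover have "?f L \<in> complex_hyperbolic_boundary H"
  proof -
    obtain v where v: "L = vec.span {v}" "v \<noteq> 0" "herm K v v = 0"
      using L(1) by (auto simp: complex_hyperbolic_boundary_def)
    have "U *v v \<noteq> 0"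
      using v(2) VU by (metis matrix_vector_mul_assoc matrix_vector_mul_lid matrix_vector_mult_0_right)
    moreover have "herm H (U *v v) (U *v v) = 0"
      using iso v(3) by (simp add: isometric_inverses_def)
    ultimately show ?thesis
      unfolding complex_hyperbolic_boundary_def v(1) image_line by blast
  qed
  ultimately show ?thesis
    using SU_transport[OF iso] par by (auto simp: parabolic_def)
qed

lemma SU_isometric_inverses:
  assumes "C \<in> SU H"
  shows "isometric_inverses H H C (matrix_inv C)"
proof -
  have "invertible C" using assms by (simp add: SU_def invertible_det_nz)
  then have "C ** matrix_inv C = mat 1" "matrix_inv C ** C = mat 1"
    unfolding invertible_def matrix_inv_def by (rule someI2_ex; blast)+
  then show ?thesis using assms by (simp add: isometric_inverses_def SU_def)
qed

lemma SU_mult: "X \<in> SU H \<Longrightarrow> Y \<in> SU H \<Longrightarrow> X ** Y \<in> SU H"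
  by (simp add: SU_def det_mul matrix_vector_mul_assoc[symmetric])

lemma SU_matrix_inv:
  assumes "X \<in> SU H" shows "matrix_inv X \<in> SU H"
proof -
  have iso: "isometric_inverses H H (matrix_inv X) X"
    using SU_isometric_inverses[OF assms] by (rule isometric_inverses_sym)
  then have "matrix_inv X ** X = mat 1" by (simp add: isometric_inverses_def)
  then have "det (matrix_inv X) * det X = 1" by (metis det_I det_mul)
  then show ?thesis using iso assms by (simp add: SU_def isometric_inverses_def)
qed

lemma parabolic_conj:
  assumes "C \<in> SU H" "parabolic H X"
  shows "parabolic H (C ** X ** matrix_inv C)"
  using parabolic_transport[OF SU_isometric_inverses[OF assms(1)] assms(2)] .

lemma parabolic_matrix_inv:
  assumes "parabolic H X"
  shows "parabolic H (matrix_inv X)"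
proof -
  have X: "X \<in> SU H" using assms by (simp add: parabolic_def)
  then have i: "X ** matrix_inv X = mat 1" "matrix_inv X ** X = mat 1"
    using SU_isometric_inverses[OF X] by (auto simp: isometric_inverses_def)
  have "(\<lambda>z. matrix_inv X *v z) ` L = L \<longleftrightarrow> (\<lambda>z. X *v z) ` L = L" for L
  proof -
    have "(\<lambda>z. matrix_inv X *v z) ` (\<lambda>z. X *v z) ` L = L"
      "(\<lambda>z. X *v z) ` (\<lambda>z. matrix_inv X *v z) ` L = L"
      by (simp_all add: image_image matrix_vector_mul_assoc i)
    then show ?thesis by metis
  qed
  then have "fixed_points H (matrix_inv X) = fixed_points H X"
    by (simp add: fixed_points_def)
  then show ?thesis using assms SU_matrix_inv[OF X] by (simp add: parabolic_def)
qed

section \<open>Jordan blocks and parabolic elements\<close>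

text \<open>The negative direction comes first, which matches the signs of \<open>k + |t\<^sub>i|\<^sup>2\<close> in the
family constructed below.\<close>
definition std_form :: "complex^3^3" where
  "std_form = vector [vector [-1, 0, 0], vector [0, 1, 0], vector [0, 0, 1]]"

lemma herm_std_form:
  "herm std_form z w = - z $ 1 * cnj (w $ 1) + z $ 2 * cnj (w $ 2) + z $ 3 * cnj (w $ 3)"
  by (simp add: herm_def std_form_def sum_3)

text \<open>Subtracting a multiple of \<open>v\<close> to kill the first coordinate does not change the norm of \<open>x\<close>, and a vector
with vanishing first coordinate is non-positive only if it is zero.\<close>
lemma std_form_nonpositive_orthogonal_to_null:
  fixes v x :: "complex^3"
  assumes v: "v \<noteq> 0" "herm std_form v v = 0"
    and x: "herm std_form x v = 0" "Re (herm std_form x x) \<le> 0"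
  shows "\<exists>c. x = c *s v"
proof -
  have "v $ 1 \<noteq> 0"
  proof
    assume "v $ 1 = 0"
    then have "complex_of_real ((cmod (v $ 2))\<^sup>2 + (cmod (v $ 3))\<^sup>2) = 0"
      using v(2) by (simp add: herm_std_form complex_norm_square del: of_real_power)
    then have "(cmod (v $ 2))\<^sup>2 + (cmod (v $ 3))\<^sup>2 = 0"
      using of_real_eq_0_iff by blast
    then have "v = 0" using \<open>v $ 1 = 0\<close> by (simp add: vec_eq_iff forall_3)
    then show False using v(1) by simp
  qed
  define c where "c = x $ 1 / v $ 1"
  define y where "y = x + (- c) *s v"
  have x_eq: "x = y + c *s v" by (simp add: y_def vec_eq_iff)
  have y1: "y $ 1 = 0" using \<open>v $ 1 \<noteq> 0\<close> by (simp add: y_def c_def)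
  have yv: "herm std_form y v = 0"
    using v(2) x(1) by (simp only: y_def herm_linear) simp
  then have "cnj (herm std_form y v) = 0" by simp
  then have "herm std_form v y = 0" by (simp add: herm_std_form mult.commute)
  then have "herm std_form x x = herm std_form y y"
    using yv v(2) by (simp only: x_eq herm_linear) simp
  then have "(cmod (y $ 2))\<^sup>2 + (cmod (y $ 3))\<^sup>2 \<le> 0"
    using x(2) y1 by (simp add: herm_std_form complex_norm_square[symmetric])
  then have "y = 0"
    using y1 by (simp add: vec_eq_iff forall_3 sum_power2_le_zero_iff)
  then show ?thesis using x_eq by auto
qed

text \<open>Invariance of the form applied to \<open>v\<close> and \<open>u\<close> shows that \<open>v\<close> is null and, more generally, that every
eigenvector of \<open>X\<close> is orthogonal to \<open>v\<close>: for an eigenvalue other than \<open>l\<close> pair it with \<open>v\<close>, for the eigenvalue \<open>l\<close> pair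
it with \<open>u\<close>. A non-positive eigenvector is therefore a multiple of \<open>v\<close>.\<close>
lemma parabolic_if_Jordan_block:
  fixes X :: "complex^3^3"
  assumes X: "X \<in> SU std_form" and l: "cmod l = 1" and v: "v \<noteq> 0"
    and Xv: "X *v v = l *s v" and Xu: "X *v u = l *s u + v"
  shows "parabolic std_form X"
proof -
  have pres: "herm std_form (X *v x) (X *v y) = herm std_form x y" for x y
    using X by (simp add: SU_def)
  have ll: "l * cnj l = 1" using l by (simp flip: complex_norm_square)
  have l0: "l \<noteq> 0" using l by auto
  have null: "herm std_form x v = 0" if "X *v x = n *s x" for x n
  proof (cases "n * cnj l = 1")
    case False
    have "n * cnj l * herm std_form x v = herm std_form x v"
      using pres[of x v] by (simp only: that Xv herm_linear) (simp only: mult_ac)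
    then show ?thesis using False by simp
  next
    case True
    then have "n = l" using ll by (metis mult_cancel_right mult_zero_right zero_neq_one)
    then have "l * (cnj l * herm std_form x u + herm std_form x v) = herm std_form x u"
      using pres[of x u] by (simp add: that Xu herm_linear algebra_simps)
    then have "l * herm std_form x v = herm std_form x u - (l * cnj l) * herm std_form x u"
      by (simp add: algebra_simps)
    then show ?thesis using ll l0 by simp
  qed
  have vv: "herm std_form v v = 0" using null[OF Xv] .
  let ?L = "vec.span {v}"
  have bd: "?L \<in> complex_hyperbolic_boundary std_form"
    using v vv by (auto simp: complex_hyperbolic_boundary_def)
  have scaled: "vec.span {c *s w} = vec.span {w}" if "c \<noteq> 0" for c and w :: "complex^3"
    using that by (auto simp: vec.span_singleton image_iff)
      (metis nonzero_divide_eq_eq)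
  have "M = ?L" if M: "M \<in> fixed_points std_form X" for M
  proof -
    obtain x where x: "M = vec.span {x}" "x \<noteq> 0" "Re (herm std_form x x) \<le> 0"
    proof -
      have "M \<in> complex_hyperbolic_plane std_form \<union> complex_hyperbolic_boundary std_form"
        using M by (simp add: fixed_points_def)
      then obtain x where "M = vec.span {x}" "Re (herm std_form x x) < 0 \<or> x \<noteq> 0 \<and> herm std_form x x = 0"
        by (auto simp: complex_hyperbolic_plane_def complex_hyperbolic_boundary_def)
      moreover have "herm std_form 0 0 = 0" by (simp add: herm_def)
      ultimately show thesis by (intro that[of x]) auto
    qed
    have "X *v x \<in> M"
      using M x(1) vec.span_base[of x "{x}"] by (auto simp: fixed_points_def)
    then obtain n where "X *v x = n *s x" by (auto simp: x(1) vec.span_singleton)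
    then obtain c where c: "x = c *s v"
      using std_form_nonpositive_orthogonal_to_null[OF v vv null x(3)] by blast
    then have "c \<noteq> 0" using x(2) by auto
    then show "M = ?L" using scaled x(1) c by simp
  qed
  moreover have "?L \<in> fixed_points std_form X"
    using bd scaled[OF l0] by (simp add: fixed_points_def image_line Xv)
  ultimately have "fixed_points std_form X = {?L}" by blast
  then show ?thesis using X bd by (auto simp: parabolic_def)
qed

definition adjugate :: "complex^3^3 \<Rightarrow> complex^3^3" where
  "adjugate X = vector
    [vector [X$2$2 * X$3$3 - X$2$3 * X$3$2, X$1$3 * X$3$2 - X$1$2 * X$3$3, X$1$2 * X$2$3 - X$1$3 * X$2$2],
     vector [X$2$3 * X$3$1 - X$2$1 * X$3$3, X$1$1 * X$3$3 - X$1$3 * X$3$1, X$1$3 * X$2$1 - X$1$1 * X$2$3],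
     vector [X$2$1 * X$3$2 - X$2$2 * X$3$1, X$1$2 * X$3$1 - X$1$1 * X$3$2, X$1$1 * X$2$2 - X$1$2 * X$2$1]]"

lemma adjugate_mult: "adjugate X ** X = mat (det X)"
  unfolding vec_eq_iff forall_3
  by (simp add: adjugate_def matrix_matrix_mult_def sum_3 mat_def det_3 algebra_simps)

lemma adjugate_mult_vec:
  "adjugate X *v y = X *v (X *v y) - trace X *s (X *v y) + trace (adjugate X) *s y"
  unfolding vec_eq_iff forall_3
  by (simp add: adjugate_def matrix_vector_mult_def sum_3 trace_def algebra_simps)

text \<open>The adjoint \<open>J X\<^sup>* J\<close> with respect to \<^const>\<open>std_form\<close>.\<close>
definition std_adjoint :: "complex^3^3 \<Rightarrow> complex^3^3" where
  "std_adjoint X = vector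
    [vector [cnj (X$1$1), - cnj (X$2$1), - cnj (X$3$1)],
     vector [- cnj (X$1$2), cnj (X$2$2), cnj (X$3$2)],
     vector [- cnj (X$1$3), cnj (X$2$3), cnj (X$3$3)]]"

lemma herm_std_adjoint: "herm std_form (std_adjoint X *v x) y = herm std_form x (X *v y)"
  by (simp add: herm_std_form std_adjoint_def matrix_vector_mult_def sum_3 algebra_simps)

lemma std_form_nondegenerate:
  assumes "\<And>y. herm std_form x y = 0" shows "x = 0"
  using assms[of "axis 1 1"] assms[of "axis 2 1"] assms[of "axis 3 1"]
  by (simp add: herm_std_form vec_eq_iff forall_3 axis_def)

lemma std_adjoint_mult:
  assumes "X \<in> SU std_form"
  shows "std_adjoint X ** X = mat 1"
proof -
  have "(std_adjoint X ** X) *v x = x" for x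
  proof -
    have "herm std_form ((std_adjoint X ** X) *v x + (-1) *s x) y = 0" for y
      using assms
      by (simp only: herm_linear matrix_vector_mul_assoc[symmetric] herm_std_adjoint) (simp add: SU_def)
    then have "(std_adjoint X ** X) *v x + (-1) *s x = 0"
      by (rule std_form_nondegenerate)
    then show ?thesis by (simp add: vec_eq_iff)
  qed
  then show ?thesis by (simp add: matrix_eq)
qed

text \<open>The Cayley-Hamilton theorem. The inverse of \<open>X\<close> is both the adjugate and the adjoint of \<open>X\<close>, so the
second coefficient of the characteristic polynomial is the conjugate of the trace.\<close>
lemma SU_inverse_quadratic:
  assumes "X \<in> SU std_form"
  shows "std_adjoint X *v y = X *v (X *v y) - trace X *s (X *v y) + cnj (trace X) *s y"
proof -
  have "adjugate X ** X = mat 1"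
    using assms by (simp add: adjugate_mult SU_def)
  moreover have "X ** std_adjoint X = mat 1"
    using std_adjoint_mult[OF assms] by (simp add: matrix_left_right_inverse)
  ultimately have "adjugate X = std_adjoint X"
    by (metis matrix_mul_assoc matrix_mul_lid matrix_mul_rid)
  moreover have "trace (std_adjoint X) = cnj (trace X)"
    by (simp add: trace_def std_adjoint_def sum_3)
  ultimately show ?thesis using adjugate_mult_vec[of X y] by simp
qed

text \<open>With eigenvalues \<open>l, l, l\<^sup>-\<^sup>2\<close>, the matrix \<open>X\<close> has a Jordan block unless \<open>(X - l)(X - l\<^sup>-\<^sup>2) = 0\<close>. After
multiplication by \<open>l X\<^sup>-\<^sup>1\<close> that equation says that \<open>X\<^sup>-\<^sup>1 + l X\<close> is a scalar matrix; on the
diagonal, \<open>cnj X\<^sub>i\<^sub>i + l X\<^sub>i\<^sub>i\<close> would not depend on \<open>i\<close>, which puts the three entries on a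
real line. The vertices of an equilateral triangle are not collinear.\<close>
lemma Jordan_block_if_equilateral_diagonal:
  fixes X :: "complex^3^3"
  assumes X: "X \<in> SU std_form" and l: "cmod l = 1" and tr: "trace X = 2 * l + (cnj l)\<^sup>2"
    and d1: "X$1$1 = m + d" and d2: "X$2$2 = m + e * d" and d3: "X$3$3 = m + e\<^sup>2 * d"
    and e: "e\<^sup>2 + e + 1 = 0" and d: "d \<noteq> 0"
  obtains u v where "v \<noteq> 0" "X *v v = l *s v" "X *v u = l *s u + v"
proof -
  have ll: "l * cnj l = 1" using l by (simp flip: complex_norm_square)
  \<comment> \<open>\<open>Z = (X - l)(X - l\<^sup>-\<^sup>2)\<close>, written with \<open>l\<^sup>-\<^sup>1 = cnj l\<close>.\<close>
  define Z where "Z y = X *v (X *v y) - (l + (cnj l)\<^sup>2) *s (X *v y) + cnj l *s y" for y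
  have XZ: "X *v Z y = l *s Z y" for y
  proof -
    have "X *v (std_adjoint X *v y) = y"
      using std_adjoint_mult[OF X] by (simp add: matrix_vector_mul_assoc matrix_left_right_inverse)
    then have *: "X *v (X *v (X *v y)) = trace X *s (X *v (X *v y)) - cnj (trace X) *s (X *v y) + y"
      unfolding SU_inverse_quadratic[OF X]
      by (simp add: matrix_vector_right_distrib matrix_vector_mult_diff_distrib
          vector_scalar_commute algebra_simps)
    have c: "l * (cnj l)\<^sup>2 = cnj l" using ll by (simp add: power2_eq_square algebra_simps)
    show ?thesis
      unfolding Z_def
      by (simp add: matrix_vector_right_distrib matrix_vector_mult_diff_distrib
          vector_scalar_commute * tr) (simp add: vec_eq_iff algebra_simps ll c power2_eq_square)
  qed
  have "\<exists>y. Z y \<noteq> 0"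
  proof (rule ccontr)
    assume "\<nexists>y. Z y \<noteq> 0"
    then have Z0: "Z y = 0" for y by blast
    have *: "std_adjoint X *v y + l *s (X *v y) = (cnj (trace X) - cnj l) *s y" for y
      using Z0[of y] unfolding SU_inverse_quadratic[OF X] Z_def tr
      by (simp add: vec_eq_iff algebra_simps)
    have "cnj (X$i$i) + l * X$i$i = cnj (trace X) - cnj l" for i
    proof -
      have "\<forall>i. cnj (X$i$i) = std_adjoint X $ i $ i"
        unfolding forall_3 by (simp add: std_adjoint_def)
      then show ?thesis
        using arg_cong[OF *[of "axis i 1"], of "\<lambda>x. x $ i"]
        by (simp add: matrix_vector_mult_def axis_def if_distrib cong: if_cong)
    qed
    then have "cnj (X$1$1) + l * X$1$1 = cnj (X$2$2) + l * X$2$2"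
      and "cnj (X$1$1) + l * X$1$1 = cnj (X$3$3) + l * X$3$3"
      by simp_all
    then have s1: "cnj d + l * d = cnj e * cnj d + l * (e * d)"
      and s2: "cnj d + l * d = (cnj e)\<^sup>2 * cnj d + l * (e\<^sup>2 * d)"
      unfolding d1 d2 d3 complex_cnj_add complex_cnj_mult complex_cnj_power distrib_left
      by algebra+
    \<comment> \<open>The three numbers \<open>cnj (e\<^sup>i d) + l e\<^sup>i d\<close> agree and add up to zero, so all vanish; comparing
      the first two gives \<open>e = cnj e\<close>, but a primitive cube root of unity is not real.\<close>
    have e': "(cnj e)\<^sup>2 + cnj e + 1 = 0"
      using arg_cong[OF e, of cnj] by simp
    have "3 * (cnj d + l * d) = ((cnj e)\<^sup>2 + cnj e + 1) * cnj d + (e\<^sup>2 + e + 1) * (l * d)"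
      using s1 s2 by (simp add: algebra_simps)
    then have "3 * (cnj d + l * d) = 0" by (simp only: e e') simp
    then have "cnj d = - (l * d)" by (simp only: mult_eq_0_iff eq_neg_iff_add_eq_0) simp
    then have "(e - cnj e) * (l * d) = 0" using s1 by algebra
    then have "cnj e = e" using d ll by auto
    then obtain x where x: "e = complex_of_real x" by (metis Reals_cases Reals_cnj_iff)
    have "complex_of_real (x\<^sup>2 + x + 1) = 0" using e by (simp add: x)
    then have "x\<^sup>2 + x + 1 = 0" by (simp only: of_real_eq_0_iff)
    moreover have "x\<^sup>2 + x + 1 = (x + 1/2)\<^sup>2 + 3/4" by (simp add: power2_eq_square algebra_simps)
    ultimately show False using zero_le_power2[of "x + 1/2"] by linarith
  qed
  then obtain y where "Z y \<noteq> 0" by blast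
  moreover have "X *v (X *v y - (cnj l)\<^sup>2 *s y) = l *s (X *v y - (cnj l)\<^sup>2 *s y) + Z y"
    using ll unfolding Z_def
    by (simp add: matrix_vector_mult_diff_distrib vector_scalar_commute)
       (simp add: vec_eq_iff algebra_simps power2_eq_square)
  ultimately show thesis using XZ that by blast
qed

text \<open>A cube keeps the Jordan block, with \<open>3 l\<^sup>2 v\<close> in place of \<open>v\<close>.\<close>
lemma parabolic_cube_if_Jordan_block:
  fixes X :: "complex^3^3"
  assumes X: "X \<in> SU std_form" and l: "cmod l = 1" and v: "v \<noteq> 0"
    and Xv: "X *v v = l *s v" and Xu: "X *v u = l *s u + v"
  shows "parabolic std_form (X ** X ** X)"
proof (rule parabolic_if_Jordan_block)
  show "X ** X ** X \<in> SU std_form" using X by (intro SU_mult)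
  show "cmod (l ^ 3) = 1" using l by (simp add: norm_power)
  show "(3 * l\<^sup>2) *s v \<noteq> 0" using v l by auto
  show "(X ** X ** X) *v ((3 * l\<^sup>2) *s v) = l ^ 3 *s ((3 * l\<^sup>2) *s v)"
    by (simp add: matrix_vector_mul_assoc[symmetric] vector_scalar_commute Xv)
       (simp add: vec_eq_iff eval_nat_numeral)
  show "(X ** X ** X) *v u = l ^ 3 *s u + (3 * l\<^sup>2) *s v"
    by (simp add: matrix_vector_mul_assoc[symmetric] vector_scalar_commute Xv Xu
        matrix_vector_right_distrib)
       (simp add: vec_eq_iff power2_eq_square power3_eq_cube algebra_simps)
qed

section \<open>Words in two elements of order three\<close>

text \<open>Inverses are written as squares, so that all words are products of \<open>S\<close> and \<open>T\<close> and an identity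
between them only needs the cancellation of cubes. The conjugations are
\<open>B = T(ST)T\<^sup>-\<^sup>1\<close>, \<open>AB = S(ST)\<^sup>-\<^sup>1S\<^sup>-\<^sup>1\<close>, \<open>AB\<^sup>2 = (ST\<^sup>-\<^sup>1)[S,T](ST\<^sup>-\<^sup>1)\<^sup>-\<^sup>1\<close> and \<open>A\<^sup>2B = S[S,T]\<^sup>-\<^sup>1S\<^sup>-\<^sup>1\<close>, while
\<open>AB\<^sup>-\<^sup>1 = [S,T]\<close> and \<open>[A,B] = (ST\<^sup>-\<^sup>1)\<^sup>3\<close> hold exactly.\<close>
lemma parabolic_words:
  assumes S: "S \<in> SU H" and T: "T \<in> SU H"
    and S3: "S ** S ** S = mat 1" and T3: "T ** T ** T = mat 1"
    and ST: "parabolic H (S ** T)"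
    and N: "parabolic H ((S ** (T ** T)) ** (S ** (T ** T)) ** (S ** (T ** T)))"
    and C: "parabolic H (S ** T ** (S ** S) ** (T ** T))"
  defines "A \<equiv> S ** T" and "B \<equiv> T ** S"
  shows "parabolic H A" "parabolic H B" "parabolic H (A ** B)"
    "parabolic H (A ** matrix_inv B)" "parabolic H (A ** (B ** B))"
    "parabolic H ((A ** A) ** B)" "parabolic H (A ** B ** matrix_inv A ** matrix_inv B)"
proof -
  have inv: "matrix_inv X = Y" if "X ** Y = mat 1" for X Y :: "complex^3^3"
  proof -
    have "invertible X" using that by (metis invertible_def matrix_left_right_inverse)
    then have "matrix_inv X ** X = mat 1"
      unfolding invertible_def matrix_inv_def by (rule someI2_ex) blast
    then show ?thesis using that by (metis matrix_mul_assoc matrix_mul_lid matrix_mul_rid)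
  qed
  have S3': "S ** (S ** S) = mat 1" and T3': "T ** (T ** T) = mat 1"
    using S3 T3 by (simp_all add: matrix_mul_assoc)
  have S3x: "S ** (S ** (S ** X)) = X" and T3x: "T ** (T ** (T ** X)) = X" for X
    using S3 T3 by (simp_all add: matrix_mul_assoc)
  note cancel = matrix_mul_assoc[symmetric] S3' T3' S3x T3x matrix_mul_lid matrix_mul_rid
  have iS: "matrix_inv S = S ** S" and iT: "matrix_inv T = T ** T"
    using S3' T3' by (auto intro: inv)
  have iST: "matrix_inv (S ** T) = T ** (T ** (S ** S))"
    and iTS: "matrix_inv (T ** S) = S ** (S ** (T ** T))"
    and iC: "matrix_inv (S ** T ** (S ** S) ** (T ** T)) = T ** (S ** (T ** (T ** (S ** S))))"
    and iSTT: "matrix_inv (S ** (T ** T)) = T ** (S ** S)"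
    by (rule inv, simp only: cancel)+
  have STT: "S ** (T ** T) \<in> SU H" using S T by (intro SU_mult)
  show "parabolic H A" using ST by (simp only: A_def)
  show "parabolic H B"
    using parabolic_conj[OF T ST] by (simp only: B_def iT cancel)
  show "parabolic H (A ** B)"
    using parabolic_conj[OF S parabolic_matrix_inv[OF ST]]
    by (simp only: A_def B_def iS iST cancel)
  show "parabolic H (A ** matrix_inv B)"
    using C by (simp only: A_def B_def iTS cancel)
  show "parabolic H (A ** (B ** B))"
    using parabolic_conj[OF STT C] by (simp only: A_def B_def iSTT cancel)
  show "parabolic H ((A ** A) ** B)"
    using parabolic_conj[OF S parabolic_matrix_inv[OF C]]
    by (simp only: iC) (simp only: A_def B_def iS cancel)
  show "parabolic H (A ** B ** matrix_inv A ** matrix_inv B)"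
    using N by (simp only: A_def B_def iST iTS cancel)
qed

lemma trace_A_B_squared:
  assumes S3: "S ** S ** S = (mat 1 :: complex^3^3)" and T3: "T ** T ** T = mat 1"
  shows "trace ((S ** T) ** ((T ** S) ** (T ** S))) = trace (S ** T ** (S ** S) ** (T ** T))"
proof -
  have S3': "S ** (S ** S) = mat 1" and T3': "T ** (T ** T) = mat 1"
    using S3 T3 by (simp_all add: matrix_mul_assoc)
  have S3x: "S ** (S ** (S ** X)) = X" and T3x: "T ** (T ** (T ** X)) = X" for X
    using S3 T3 by (simp_all add: matrix_mul_assoc)
  note cancel = matrix_mul_assoc[symmetric] S3' T3' S3x T3x matrix_mul_lid matrix_mul_rid
  have "trace ((S ** T) ** ((T ** S) ** (T ** S)))
      = trace ((S ** (T ** T)) ** ((S ** T ** (S ** S) ** (T ** T)) ** (T ** (S ** S))))"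
    by (simp only: cancel)
  also have "\<dots> = trace (((S ** T ** (S ** S) ** (T ** T)) ** (T ** (S ** S))) ** (S ** (T ** T)))"
    by (rule trace_mul_sym)
  also have "\<dots> = trace (S ** T ** (S ** S) ** (T ** T))"
    by (simp only: cancel)
  finally show ?thesis .
qed

section \<open>A pair of order three elements with prescribed traces\<close>

lemma SU_std_formI:
  assumes "det X = 1"
    and c11: "- X$1$1 * cnj (X$1$1) + X$2$1 * cnj (X$2$1) + X$3$1 * cnj (X$3$1) = -1"
    and c22: "- X$1$2 * cnj (X$1$2) + X$2$2 * cnj (X$2$2) + X$3$2 * cnj (X$3$2) = 1"
    and c33: "- X$1$3 * cnj (X$1$3) + X$2$3 * cnj (X$2$3) + X$3$3 * cnj (X$3$3) = 1"
    and c12: "- X$1$1 * cnj (X$1$2) + X$2$1 * cnj (X$2$2) + X$3$1 * cnj (X$3$2) = 0"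
    and c13: "- X$1$1 * cnj (X$1$3) + X$2$1 * cnj (X$2$3) + X$3$1 * cnj (X$3$3) = 0"
    and c23: "- X$1$2 * cnj (X$1$3) + X$2$2 * cnj (X$2$3) + X$3$2 * cnj (X$3$3) = 0"
  shows "X \<in> SU std_form"
proof -
  have c21: "- X$1$2 * cnj (X$1$1) + X$2$2 * cnj (X$2$1) + X$3$2 * cnj (X$3$1) = 0"
    using arg_cong[OF c12, of cnj] by (simp add: mult.commute)
  have c31: "- X$1$3 * cnj (X$1$1) + X$2$3 * cnj (X$2$1) + X$3$3 * cnj (X$3$1) = 0"
    using arg_cong[OF c13, of cnj] by (simp add: mult.commute)
  have c32: "- X$1$3 * cnj (X$1$2) + X$2$3 * cnj (X$2$2) + X$3$3 * cnj (X$3$2) = 0"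
    using arg_cong[OF c23, of cnj] by (simp add: mult.commute)
  have "std_adjoint X ** X = mat 1"
    unfolding vec_eq_iff forall_3 matrix_matrix_mult_def
    using c11 c22 c33 c12 c13 c23 c21 c31 c32
    by (simp add: std_adjoint_def sum_3 mat_def) (simp add: algebra_simps)
  then have "herm std_form (X *v x) (X *v y) = herm std_form x y" for x y
    by (simp add: herm_std_adjoint[symmetric] matrix_vector_mul_assoc)
  then show ?thesis using assms(1) by (simp add: SU_def)
qed

lemma cube_eq_one_if_trace_zero:
  assumes X: "X \<in> SU std_form" and "trace X = 0"
  shows "X ** X = std_adjoint X" "X ** X ** X = mat 1"
proof -
  show XX: "X ** X = std_adjoint X"
    using SU_inverse_quadratic[OF X] assms(2)
    by (simp add: matrix_eq matrix_vector_mul_assoc)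
  show "X ** X ** X = mat 1"
    using std_adjoint_mult[OF X] by (simp add: XX)
qed

text \<open>This is the general form of a unitary matrix with diagonal \<open>t1, t2, t3\<close>, normalized by a diagonal
conjugation so that the entries \<open>(1,2)\<close> and \<open>(2,3)\<close> are positive. Since the inverse is both the adjugate and
the adjoint, \<open>T\<^sub>1\<^sub>2 T\<^sub>2\<^sub>1 = t1 t2 - cnj t3\<close>, and cyclically. The products \<open>q = T\<^sub>1\<^sub>2 T\<^sub>2\<^sub>3 T\<^sub>3\<^sub>1\<close> and
\<open>q' = T\<^sub>2\<^sub>1 T\<^sub>3\<^sub>2 T\<^sub>1\<^sub>3\<close> have a known sum, by \<open>det T = 1\<close>, and a known product; they are the numbers \<open>t1 t2 t3 + k\<close>
for the two roots \<open>k\<close> of a real quadratic equation. Unitarity then fixes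
\<open>|T\<^sub>1\<^sub>2|\<^sup>2 = - (k + |t3|\<^sup>2)\<close> and \<open>|T\<^sub>2\<^sub>3|\<^sup>2 = k + |t1|\<^sup>2\<close>. The cube is the identity when moreover
\<open>t1 + t2 + t3 = 0\<close>.\<close>
definition order_three_elt :: "complex \<Rightarrow> complex \<Rightarrow> complex \<Rightarrow> real \<Rightarrow> complex^3^3" where
  "order_three_elt t1 t2 t3 k =
    (let a = complex_of_real (sqrt (- (k + (cmod t3)\<^sup>2)));
         b = complex_of_real (sqrt (k + (cmod t1)\<^sup>2));
         q = t1 * t2 * t3 + complex_of_real k
     in vector [vector [t1, a, (t3 * t1 - cnj t2) * (a * b) / q],
                vector [(t1 * t2 - cnj t3) / a, t2, b],
                vector [q / (a * b), (t2 * t3 - cnj t1) / b, t3]])"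

text \<open>The unitarity relations as rational identities: \<open>u1, u2, u3, r\<close> stand for the complex conjugates of
\<open>t1, t2, t3, q\<close>, and \<open>E\<close> is the quadratic equation for \<open>k\<close>. Once denominators are cleared, each
numerator is a multiple of \<open>E\<close>.\<close>
lemma order_three_identities:
  fixes t1 t2 t3 u1 u2 u3 k a b q r :: complex
  assumes E: "k\<^sup>2 + k * (t1*u1 + t2*u2 + t3*u3 - 1)
      + t1*u1*(t2*u2) + t2*u2*(t3*u3) + t3*u3*(t1*u1) - t1*t2*t3 - u1*u2*u3 = 0"
    and a: "a * a = - (k + t3*u3)" "a \<noteq> 0" and b: "b * b = k + t1*u1" "b \<noteq> 0"
    and q: "q = t1*t2*t3 + k" "q \<noteq> 0" and r: "r = u1*u2*u3 + k" "r \<noteq> 0"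
  shows "- t1*u1 + (t1*t2 - u3)/a * ((u1*u2 - t3)/a) + q/(a*b) * (r/(a*b)) = -1"
    and "- a*a + t2*u2 + (t2*t3 - u1)/b * ((u2*u3 - t1)/b) = 1"
    and "- ((t3*t1 - u2)*(a*b)/q) * ((u3*u1 - t2)*(a*b)/r) + b*b + t3*u3 = 1"
    and "- t1*a + (t1*t2 - u3)/a * u2 + q/(a*b) * ((u2*u3 - t1)/b) = 0"
    and "- t1*((u3*u1 - t2)*(a*b)/r) + (t1*t2 - u3)/a * b + q/(a*b) * u3 = 0"
    and "- a*((u3*u1 - t2)*(a*b)/r) + t2*b + (t2*t3 - u1)/b*u3 = 0"
    and "t1*t2*t3 + a*b*(q/(a*b)) + (t3*t1 - u2)*(a*b)/q * ((t1*t2 - u3)/a) * ((t2*t3 - u1)/b)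
      - t1*b*((t2*t3 - u1)/b) - a*((t1*t2 - u3)/a)*t3 - (t3*t1 - u2)*(a*b)/q*t2*(q/(a*b)) = 1"
proof -
  let ?p1 = "k + t1*u1" and ?p2 = "k + t2*u2" and ?p3 = "k + t3*u3"
  have p: "?p1 \<noteq> 0" "?p3 \<noteq> 0" using a b by (metis mult_eq_0_iff neg_equal_0_iff_equal)+
  \<comment> \<open>The other root of \<open>E\<close> is \<open>k' = 1 - n1 - n2 - n3 - k\<close> with \<open>n\<^sub>i = t\<^sub>i u\<^sub>i\<close>; the last factors
    of \<open>P12\<close>, \<open>P23\<close>, \<open>P31\<close> are \<open>k' + n3\<close>, \<open>k' + n1\<close>, \<open>k' + n2\<close>.\<close>
  have qr: "q * r = ?p1 * ?p2 * ?p3" using E q r by algebra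
  have P12: "(t1*t2 - u3) * (u1*u2 - t3) = ?p3 * (1 - t1*u1 - t2*u2 - k)" using E by algebra
  have P23: "(t2*t3 - u1) * (u2*u3 - t1) = ?p1 * (1 - t2*u2 - t3*u3 - k)" using E by algebra
  have P31: "(t3*t1 - u2) * (u3*u1 - t2) = ?p2 * (1 - t3*u3 - t1*u1 - k)" using E by algebra
  have PPP: "(t1*t2 - u3) * (t2*t3 - u1) * (t3*t1 - u2)
      = q * (t1*t2*t3 + 1 - t1*u1 - t2*u2 - t3*u3 - k)" using E q by algebra
  have p2: "?p2 \<noteq> 0" using qr q r by auto
  have "(t1*t2 - u3)/a * ((u1*u2 - t3)/a) = ?p3 * (1 - t1*u1 - t2*u2 - k) / (a * a)"
    unfolding P12[symmetric] by simp
  also have "\<dots> = - (1 - t1*u1 - t2*u2 - k)" unfolding a(1) minus_divide_right[symmetric] using p by simp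
  finally have x1: "(t1*t2 - u3)/a * ((u1*u2 - t3)/a) = - (1 - t1*u1 - t2*u2 - k)" .
  have "q/(a*b) * (r/(a*b)) = (q * r) / ((a * a) * (b * b))" by simp
  also have "\<dots> = - ?p2" unfolding a(1) b(1) qr mult_minus_left minus_divide_right[symmetric] using p by simp
  finally have x2: "q/(a*b) * (r/(a*b)) = - ?p2" .
  show "- t1*u1 + (t1*t2 - u3)/a * ((u1*u2 - t3)/a) + q/(a*b) * (r/(a*b)) = -1"
    unfolding x1 x2 by simp
  have "(t2*t3 - u1)/b * ((u2*u3 - t1)/b) = ?p1 * (1 - t2*u2 - t3*u3 - k) / (b * b)"
    unfolding P23[symmetric] by simp
  also have "\<dots> = 1 - t2*u2 - t3*u3 - k" unfolding b using p by simp
  finally have x3: "(t2*t3 - u1)/b * ((u2*u3 - t1)/b) = 1 - t2*u2 - t3*u3 - k" .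
  show "- a*a + t2*u2 + (t2*t3 - u1)/b * ((u2*u3 - t1)/b) = 1"
    unfolding x3 using a(1) by (simp add: algebra_simps)
  have "((t3*t1 - u2)*(a*b)/q) * ((u3*u1 - t2)*(a*b)/r)
      = (t3*t1 - u2) * (u3*u1 - t2) * ((a*a) * (b*b)) / (q*r)" by simp
  also have "\<dots> = - (1 - t3*u3 - t1*u1 - k)"
    unfolding P31 qr a b using p p2 by (simp add: divide_simps) (simp add: algebra_simps)
  finally have x4: "((t3*t1 - u2)*(a*b)/q) * ((u3*u1 - t2)*(a*b)/r) = - (1 - t3*u3 - t1*u1 - k)" .
  show "- ((t3*t1 - u2)*(a*b)/q) * ((u3*u1 - t2)*(a*b)/r) + b*b + t3*u3 = 1"
    unfolding mult_minus_left x4 b(1) by simp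
  have "- t1*a + (t1*t2 - u3)/a * u2 + q/(a*b) * ((u2*u3 - t1)/b)
      = (- t1*(a*a)*(b*b) + (t1*t2 - u3)*u2*(b*b) + q*(u2*u3 - t1)) / (a*(b*b))"
    using a(2) b(2) by (simp add: divide_simps) (simp add: algebra_simps)?
  also have "- t1*(a*a)*(b*b) + (t1*t2 - u3)*u2*(b*b) + q*(u2*u3 - t1) = 0"
    unfolding a b using E q by algebra
  finally show "- t1*a + (t1*t2 - u3)/a * u2 + q/(a*b) * ((u2*u3 - t1)/b) = 0" by simp
  have "- t1*((u3*u1 - t2)*(a*b)/r) + (t1*t2 - u3)/a * b + q/(a*b) * u3
      = (- t1*(u3*u1 - t2)*((a*a)*(b*b)) + (t1*t2 - u3)*(b*b)*r + (q*r)*u3) / (a*b*r)"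
    using a(2) b(2) r(2) by (simp add: divide_simps) (simp add: algebra_simps)?
  also have "- t1*(u3*u1 - t2)*((a*a)*(b*b)) + (t1*t2 - u3)*(b*b)*r + (q*r)*u3 = 0"
    unfolding a b qr using E r by algebra
  finally show "- t1*((u3*u1 - t2)*(a*b)/r) + (t1*t2 - u3)/a * b + q/(a*b) * u3 = 0" by simp
  have "- a*((u3*u1 - t2)*(a*b)/r) + t2*b + (t2*t3 - u1)/b*u3
      = (- (u3*u1 - t2)*((a*a)*(b*b)) + t2*(b*b)*r + (t2*t3 - u1)*u3*r) / (b*r)"
    using b(2) r(2) by (simp add: divide_simps) (simp add: algebra_simps)?
  also have "- (u3*u1 - t2)*((a*a)*(b*b)) + t2*(b*b)*r + (t2*t3 - u1)*u3*r = 0"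
    unfolding a b using E r by algebra
  finally show "- a*((u3*u1 - t2)*(a*b)/r) + t2*b + (t2*t3 - u1)/b*u3 = 0" by simp
  have "t1*t2*t3 + a*b*(q/(a*b)) + (t3*t1 - u2)*(a*b)/q * ((t1*t2 - u3)/a) * ((t2*t3 - u1)/b)
      - t1*b*((t2*t3 - u1)/b) - a*((t1*t2 - u3)/a)*t3 - (t3*t1 - u2)*(a*b)/q*t2*(q/(a*b))
     = t1*t2*t3 + q + ((t1*t2 - u3) * (t2*t3 - u1) * (t3*t1 - u2)) / q
      - t1*(t2*t3 - u1) - (t1*t2 - u3)*t3 - (t3*t1 - u2)*t2"
    using a(2) b(2) q(2) by simp
  also have "\<dots> = t1*t2*t3 + q + (t1*t2*t3 + 1 - t1*u1 - t2*u2 - t3*u3 - k)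
      - t1*(t2*t3 - u1) - (t1*t2 - u3)*t3 - (t3*t1 - u2)*t2"
    unfolding PPP using q(2) by simp
  also have "\<dots> = 1" unfolding q(1) by (simp add: algebra_simps)
  finally show "t1*t2*t3 + a*b*(q/(a*b)) + (t3*t1 - u2)*(a*b)/q * ((t1*t2 - u3)/a) * ((t2*t3 - u1)/b)
      - t1*b*((t2*t3 - u1)/b) - a*((t1*t2 - u3)/a)*t3 - (t3*t1 - u2)*(a*b)/q*t2*(q/(a*b)) = 1" .
qed

text \<open>The second formula shows that the signs of the factors \<open>k + |t\<^sub>i|\<^sup>2\<close> are not independent: if the product
does not vanish, then an even number of them is negative. An even number different from zero is
the case of an indefinite form.\<close>
lemma order_three_quadratic:
  fixes t1 t2 t3 :: complex and k :: real
  assumes E: "k\<^sup>2 + k * ((cmod t1)\<^sup>2 + (cmod t2)\<^sup>2 + (cmod t3)\<^sup>2 - 1)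
      + (cmod t1)\<^sup>2 * (cmod t2)\<^sup>2 + (cmod t2)\<^sup>2 * (cmod t3)\<^sup>2 + (cmod t3)\<^sup>2 * (cmod t1)\<^sup>2
      = 2 * Re (t1 * t2 * t3)"
  shows "(complex_of_real k)\<^sup>2
      + complex_of_real k * (t1 * cnj t1 + t2 * cnj t2 + t3 * cnj t3 - 1)
      + t1 * cnj t1 * (t2 * cnj t2) + t2 * cnj t2 * (t3 * cnj t3) + t3 * cnj t3 * (t1 * cnj t1)
      - t1 * t2 * t3 - cnj t1 * cnj t2 * cnj t3 = 0" (is ?quadratic)
    and "(cmod (t1 * t2 * t3 + complex_of_real k))\<^sup>2
      = (k + (cmod t1)\<^sup>2) * (k + (cmod t2)\<^sup>2) * (k + (cmod t3)\<^sup>2)"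
proof -
  define q where "q = t1 * t2 * t3 + complex_of_real k"
  have "t1 * t2 * t3 + cnj t1 * cnj t2 * cnj t3
      = complex_of_real 2 * complex_of_real (Re (t1 * t2 * t3))"
    using complex_add_cnj[of "t1 * t2 * t3"] by (simp del: times_complex.sel)
  with arg_cong[OF E, of complex_of_real] show E': ?quadratic
    unfolding of_real_add of_real_mult of_real_diff of_real_1 complex_norm_square
    unfolding of_real_power by algebra
  have cq: "cnj q = cnj t1 * cnj t2 * cnj t3 + complex_of_real k"
    by (simp add: q_def)
  have "q * cnj q = (complex_of_real k + t1 * cnj t1) * (complex_of_real k + t2 * cnj t2)
      * (complex_of_real k + t3 * cnj t3)"
    unfolding cq unfolding q_def using E' by algebra
  then have "complex_of_real ((cmod q)\<^sup>2)
      = complex_of_real ((k + (cmod t1)\<^sup>2) * (k + (cmod t2)\<^sup>2) * (k + (cmod t3)\<^sup>2))"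
    unfolding of_real_add of_real_mult complex_norm_square .
  then show "(cmod (t1 * t2 * t3 + complex_of_real k))\<^sup>2
      = (k + (cmod t1)\<^sup>2) * (k + (cmod t2)\<^sup>2) * (k + (cmod t3)\<^sup>2)"
    unfolding of_real_eq_iff q_def .
qed

lemma order_three_elt_SU:
  fixes t1 t2 t3 :: complex and k :: real
  assumes E: "k\<^sup>2 + k * ((cmod t1)\<^sup>2 + (cmod t2)\<^sup>2 + (cmod t3)\<^sup>2 - 1)
      + (cmod t1)\<^sup>2 * (cmod t2)\<^sup>2 + (cmod t2)\<^sup>2 * (cmod t3)\<^sup>2 + (cmod t3)\<^sup>2 * (cmod t1)\<^sup>2
      = 2 * Re (t1 * t2 * t3)"
    and p1: "k + (cmod t1)\<^sup>2 > 0" and p2: "k + (cmod t2)\<^sup>2 \<noteq> 0" and p3: "k + (cmod t3)\<^sup>2 < 0"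
  defines "T \<equiv> order_three_elt t1 t2 t3 k"
  shows "T \<in> SU std_form"
    and "T$1$1 = t1" "T$2$2 = t2" "T$3$3 = t3"
    and "T$1$2 * cnj (T$1$2) = complex_of_real (- (k + (cmod t3)\<^sup>2))"
    and "T$2$3 * cnj (T$2$3) = complex_of_real (k + (cmod t1)\<^sup>2)"
proof -
  define a where "a = complex_of_real (sqrt (- (k + (cmod t3)\<^sup>2)))"
  define b where "b = complex_of_real (sqrt (k + (cmod t1)\<^sup>2))"
  define q where "q = t1 * t2 * t3 + complex_of_real k"
  have real_ab: "cnj a = a" "cnj b = b" by (simp_all add: a_def b_def)
  have aa: "a * a = complex_of_real (- (k + (cmod t3)\<^sup>2))"
    unfolding a_def of_real_mult[symmetric] using p3 by (subst real_sqrt_mult_self) simp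
  have bb: "b * b = complex_of_real (k + (cmod t1)\<^sup>2)"
    unfolding b_def of_real_mult[symmetric] using p1 by (subst real_sqrt_mult_self) simp
  have a: "a * a = - (complex_of_real k + t3 * cnj t3)" "a \<noteq> 0"
    and b: "b * b = complex_of_real k + t1 * cnj t1" "b \<noteq> 0"
    using p1 p3 by (simp_all add: aa bb complex_norm_square del: of_real_power)
      (simp_all add: a_def b_def)
  have cq: "cnj q = cnj t1 * cnj t2 * cnj t3 + complex_of_real k"
    by (simp add: q_def)
  have "(cmod q)\<^sup>2 \<noteq> 0"
    unfolding q_def order_three_quadratic(2)[OF E] using p1 p2 p3 by simp
  then have q0: "q \<noteq> 0" "cnj q \<noteq> 0" by auto
  note ids = order_three_identities[OF order_three_quadratic(1)[OF E] a b q_def q0(1) cq q0(2)]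
  have T: "T = vector [vector [t1, a, (t3 * t1 - cnj t2) * (a * b) / q],
                vector [(t1 * t2 - cnj t3) / a, t2, b],
                vector [q / (a * b), (t2 * t3 - cnj t1) / b, t3]]"
    unfolding T_def order_three_elt_def Let_def a_def b_def q_def ..
  show "T$1$1 = t1" "T$2$2 = t2" "T$3$3 = t3" by (simp_all add: T)
  show "T$1$2 * cnj (T$1$2) = complex_of_real (- (k + (cmod t3)\<^sup>2))"
    "T$2$3 * cnj (T$2$3) = complex_of_real (k + (cmod t1)\<^sup>2)"
    using aa bb by (simp_all add: T real_ab)
  show "T \<in> SU std_form"
    by (rule SU_std_formI; insert ids; simp add: T real_ab det_3)
qed

text \<open>A primitive cube root of unity in coordinates, so that its conjugate is its square by computation.\<close>
definition omega :: complex where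
  "omega = Complex (-1/2) (sqrt 3 / 2)"

lemma omega:
  "omega\<^sup>2 = cnj omega" "(cnj omega)\<^sup>2 = omega" "omega * cnj omega = 1" "cnj omega = - 1 - omega"
  by (simp_all add: omega_def complex_eq_iff power2_eq_square)

text \<open>The element \<open>S\<close> of order three with eigenvalues \<open>1\<close>, \<open>omega\<close> and its square.\<close>
definition rot3 :: "complex^3^3" where
  "rot3 = vector [vector [1, 0, 0], vector [0, omega, 0], vector [0, 0, cnj omega]]"

lemma rot3_SU: "rot3 \<in> SU std_form"
  using omega(3) by (intro SU_std_formI) (simp_all add: rot3_def det_3 mult.commute)

lemma rot3_square: "rot3 ** rot3
    = vector [vector [1, 0, 0], vector [0, cnj omega, 0], vector [0, 0, omega]]"
  unfolding vec_eq_iff forall_3 matrix_matrix_mult_def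
  using omega(1,2) by (simp add: rot3_def sum_3 power2_eq_square)

lemma rot3_cube: "rot3 ** rot3 ** rot3 = mat 1"
  unfolding rot3_square unfolding vec_eq_iff forall_3 matrix_matrix_mult_def
  using omega(3) by (simp add: rot3_def sum_3 mat_def mult.commute)

text \<open>The diagonal entries of \<open>T\<close>: the solution of the three linear equations \<open>tr T = 0\<close>, \<open>tr ST = z\<close> and
\<open>tr S\<^sup>-\<^sup>1T = cnj w\<close>. The last one is equivalent to \<open>tr ST\<^sup>-\<^sup>1 = w\<close>.\<close>
definition diag1 :: "complex \<Rightarrow> complex \<Rightarrow> complex" where
  "diag1 z w = (z + cnj w) / 3"

definition diag2 :: "complex \<Rightarrow> complex \<Rightarrow> complex" where
  "diag2 z w = (cnj omega * z + omega * cnj w) / 3"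

definition diag3 :: "complex \<Rightarrow> complex \<Rightarrow> complex" where
  "diag3 z w = (omega * z + cnj omega * cnj w) / 3"

lemma diag_norms:
  fixes z w :: complex
  defines "s \<equiv> z * cnj z + w * cnj w"
  shows "complex_of_real ((cmod (diag1 z w))\<^sup>2) = (s + z * w + cnj (z * w)) / 9"
    and "complex_of_real ((cmod (diag2 z w))\<^sup>2) = (s + omega * (z * w) + cnj (omega * (z * w))) / 9"
    and "complex_of_real ((cmod (diag3 z w))\<^sup>2) = (s + cnj omega * (z * w) + omega * cnj (z * w)) / 9"
proof -
  note o = omega(4)
  have o2: "omega * omega = - 1 - omega"
    using omega(1) o by (simp add: power2_eq_square)
  show "complex_of_real ((cmod (diag1 z w))\<^sup>2) = (s + z * w + cnj (z * w)) / 9"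
    unfolding complex_norm_square by (simp add: diag1_def s_def algebra_simps)
  show "complex_of_real ((cmod (diag2 z w))\<^sup>2) = (s + omega * (z * w) + cnj (omega * (z * w))) / 9"
    unfolding complex_norm_square
    by (simp add: diag2_def s_def field_simps o) (use o2 in algebra)
  show "complex_of_real ((cmod (diag3 z w))\<^sup>2) = (s + cnj omega * (z * w) + omega * cnj (z * w)) / 9"
    unfolding complex_norm_square
    by (simp add: diag3_def s_def field_simps o) (use o2 in algebra)
qed

lemma diag_product: "diag1 z w * diag2 z w * diag3 z w = (z ^ 3 + cnj w ^ 3) / 27"
proof -
  have o2: "omega * omega = - 1 - omega"
    using omega(1,4) by (simp add: power2_eq_square)
  show ?thesis
    by (simp add: diag1_def diag2_def diag3_def omega(4)) (use o2 in algebra)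
qed

lemma trace_equilateral:
  fixes X :: "complex^3^3"
  assumes "X$1$1 = m + d" "X$2$2 = m + e * d" "X$3$3 = m + e\<^sup>2 * d" "e\<^sup>2 + e + 1 = 0"
  shows "trace X = 3 * m"
proof -
  have "trace X = 3 * m + (e\<^sup>2 + e + 1) * d"
    by (simp add: trace_def sum_3 assms(1-3) algebra_simps)
  then show ?thesis using assms(4) by simp
qed

lemma parabolic_if_equilateral_diagonal:
  fixes X :: "complex^3^3"
  assumes X: "X \<in> SU std_form" and l: "cmod l = 1" and m: "3 * m = 2 * l + (cnj l)\<^sup>2"
    and d: "X$1$1 = m + d" "X$2$2 = m + e * d" "X$3$3 = m + e\<^sup>2 * d"
    and e: "e\<^sup>2 + e + 1 = 0" "d \<noteq> 0"
  shows "parabolic std_form X" and "parabolic std_form (X ** X ** X)"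
proof -
  have "trace X = 2 * l + (cnj l)\<^sup>2" using trace_equilateral[OF d e(1)] m by simp
  then obtain u v where uv: "v \<noteq> 0" "X *v v = l *s v" "X *v u = l *s u + v"
    by (rule Jordan_block_if_equilateral_diagonal[OF X l _ d e])
  show "parabolic std_form X" by (rule parabolic_if_Jordan_block[OF X l uv])
  show "parabolic std_form (X ** X ** X)" by (rule parabolic_cube_if_Jordan_block[OF X l uv])
qed

text \<open>With diagonal entries as above, the product \<open>T\<^sub>1\<^sub>2 T\<^sub>2\<^sub>3 T\<^sub>3\<^sub>1 = t1 t2 t3 + k\<close> distinguishes between the
traces of \<open>[S,T]\<close> and of its inverse, which are complex conjugates: they are
\<open>3 (cnj omega k + omega k')\<close> and \<open>3 (omega k + cnj omega k')\<close>, where \<open>k + k' = 1 - (|z|\<^sup>2 + |w|\<^sup>2)/3\<close>.\<close>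
definition commutator_trace :: "complex \<Rightarrow> complex \<Rightarrow> real \<Rightarrow> complex" where
  "commutator_trace z w k = 3 * (cnj omega * of_real k
      + omega * of_real (1 - ((cmod z)\<^sup>2 + (cmod w)\<^sup>2) / 3 - k))"

lemma diag_relations:
  fixes z w :: complex
  defines "s \<equiv> (cmod z)\<^sup>2 + (cmod w)\<^sup>2"
    and "n1 \<equiv> (cmod (diag1 z w))\<^sup>2" and "n2 \<equiv> (cmod (diag2 z w))\<^sup>2" and "n3 \<equiv> (cmod (diag3 z w))\<^sup>2"
  shows "n1 + n2 + n3 = s / 3"
    and "n1 * n2 + n2 * n3 + n3 * n1 = (s\<^sup>2 - (cmod z)\<^sup>2 * (cmod w)\<^sup>2) / 27"
    and "Re (diag1 z w * diag2 z w * diag3 z w) = Re (z ^ 3 + w ^ 3) / 27"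
proof -
  define W where "W = z * w"
  have o1: "omega * omega = - 1 - omega" and o2: "cnj omega = - 1 - omega"
    using omega(1,4) by (simp_all add: power2_eq_square)
  have s: "complex_of_real s = z * cnj z + w * cnj w"
    unfolding s_def of_real_add complex_norm_square ..
  have Nn: "complex_of_real n1 = (of_real s + W + cnj W) / 9"
    "complex_of_real n2 = (of_real s + omega * W + cnj omega * cnj W) / 9"
    "complex_of_real n3 = (of_real s + cnj omega * W + omega * cnj W) / 9"
    unfolding n1_def n2_def n3_def diag_norms s W_def by simp_all
  have "complex_of_real (n1 + n2 + n3) = of_real (s / 3)"
    by (simp add: Nn o2 field_simps)
  then show "n1 + n2 + n3 = s / 3" by (simp only: of_real_eq_iff)
  have WW: "W * cnj W = complex_of_real ((cmod z)\<^sup>2 * (cmod w)\<^sup>2)"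
    by (simp add: W_def complex_norm_square del: of_real_power)
  have "complex_of_real (n1 * n2 + n2 * n3 + n3 * n1)
      = ((of_real s)\<^sup>2 - W * cnj W) / 27"
    unfolding of_real_add of_real_mult Nn o2 using o1 by (simp add: field_simps) algebra
  also have "\<dots> = complex_of_real ((s\<^sup>2 - (cmod z)\<^sup>2 * (cmod w)\<^sup>2) / 27)"
    unfolding WW by simp
  finally show "n1 * n2 + n2 * n3 + n3 * n1 = (s\<^sup>2 - (cmod z)\<^sup>2 * (cmod w)\<^sup>2) / 27"
    by (simp only: of_real_eq_iff)
  show "Re (diag1 z w * diag2 z w * diag3 z w) = Re (z ^ 3 + w ^ 3) / 27"
    unfolding diag_product
    by (simp add: complex_cnj_power[symmetric] del: complex_cnj_power)
qed

text \<open>The quadratic equation for \<open>k\<close> from \<^const>\<open>order_three_elt\<close>, expressed through \<open>z\<close> and \<open>w\<close>. In terms of the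
commutator trace \<open>c\<close> it is the formula for \<open>|c|\<^sup>2\<close> as a polynomial in \<open>z\<close>, \<open>w\<close> and their conjugates.\<close>
definition trace_relation :: "complex \<Rightarrow> complex \<Rightarrow> real \<Rightarrow> bool" where
  "trace_relation z w k \<longleftrightarrow>
    k\<^sup>2 + k * (((cmod z)\<^sup>2 + (cmod w)\<^sup>2) / 3 - 1)
       + (((cmod z)\<^sup>2 + (cmod w)\<^sup>2)\<^sup>2 - (cmod z)\<^sup>2 * (cmod w)\<^sup>2) / 27 = 2 * Re (z ^ 3 + w ^ 3) / 27"

lemma diag_quadratic:
  fixes z w :: complex
  defines "n1 \<equiv> (cmod (diag1 z w))\<^sup>2" and "n2 \<equiv> (cmod (diag2 z w))\<^sup>2" and "n3 \<equiv> (cmod (diag3 z w))\<^sup>2"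
  assumes "trace_relation z w k"
  shows "k\<^sup>2 + k * (n1 + n2 + n3 - 1) + n1 * n2 + n2 * n3 + n3 * n1
    = 2 * Re (diag1 z w * diag2 z w * diag3 z w)"
  using assms(4) diag_relations[of z w]
  unfolding trace_relation_def n1_def n2_def n3_def by (simp only: add.assoc times_divide_eq_right)

text \<open>The diagonals of \<open>ST\<close>, \<open>ST\<^sup>-\<^sup>1\<close> and \<open>[S,T]\<close> form equilateral triangles with centres \<open>z/3\<close>, \<open>w/3\<close>, \<open>c/3\<close>. For the
first two this is the Fourier form of the diagonal of \<open>T\<close>. For the commutator, whose diagonal
entries are combinations of the \<open>|T\<^sub>i\<^sub>j|\<^sup>2\<close>, one vertex minus the centre is \<open>cnj (z w)/3\<close>.\<close>
lemma order_three_pair: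
  fixes z w l n m :: complex and k :: real
  assumes l: "cmod l = 1" "z = 2 * l + (cnj l)\<^sup>2" "z \<noteq> 0"
    and n: "cmod n = 1" "w = 2 * n + (cnj n)\<^sup>2" "w \<noteq> 0"
    and m: "cmod m = 1" "commutator_trace z w k = 2 * m + (cnj m)\<^sup>2"
    and k: "trace_relation z w k"
    and p: "k + (cmod (diag1 z w))\<^sup>2 > 0" "k + (cmod (diag2 z w))\<^sup>2 < 0" "k + (cmod (diag3 z w))\<^sup>2 < 0"
  defines "T \<equiv> order_three_elt (diag1 z w) (diag2 z w) (diag3 z w) k"
  shows "T \<in> SU std_form" "T ** T ** T = mat 1"
    "parabolic std_form (rot3 ** T)"
    "parabolic std_form ((rot3 ** (T ** T)) ** (rot3 ** (T ** T)) ** (rot3 ** (T ** T)))"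
    "parabolic std_form (rot3 ** T ** (rot3 ** rot3) ** (T ** T))"
    "trace (rot3 ** T ** (rot3 ** rot3) ** (T ** T)) = commutator_trace z w k"
proof -
  define t1 t2 t3 where "t1 = diag1 z w" and "t2 = diag2 z w" and "t3 = diag3 z w"
  define n1 n2 n3 where "n1 = (cmod t1)\<^sup>2" and "n2 = (cmod t2)\<^sup>2" and "n3 = (cmod t3)\<^sup>2"
  define s where "s = (cmod z)\<^sup>2 + (cmod w)\<^sup>2"
  define W where "W = z * w"
  have o1: "omega * omega = - 1 - omega" and o2: "cnj omega = - 1 - omega"
    using omega(1,4) by (simp_all add: power2_eq_square)
  have s: "complex_of_real s = z * cnj z + w * cnj w"
    unfolding s_def of_real_add complex_norm_square ..
  have Nn: "complex_of_real n1 = (of_real s + W + cnj W) / 9"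
    "complex_of_real n2 = (of_real s + omega * W + cnj omega * cnj W) / 9"
    "complex_of_real n3 = (of_real s + cnj omega * W + omega * cnj W) / 9"
    unfolding n1_def n2_def n3_def t1_def t2_def t3_def diag_norms s W_def by simp_all
  have E: "k\<^sup>2 + k * (n1 + n2 + n3 - 1) + n1 * n2 + n2 * n3 + n3 * n1 = 2 * Re (t1 * t2 * t3)"
    using diag_quadratic[OF k] unfolding n1_def n2_def n3_def t1_def t2_def t3_def .
  note T = order_three_elt_SU[of k t1 t2 t3, folded n1_def n2_def n3_def, OF E]
  have p': "k + n1 > 0" "k + n2 \<noteq> 0" "k + n3 < 0"
    using p unfolding n1_def n2_def n3_def t1_def t2_def t3_def by auto
  note T = T[OF p', unfolded t1_def t2_def t3_def, folded T_def, folded t1_def t2_def t3_def]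
  show TSU: "T \<in> SU std_form" by (rule T(1))
  have trT: "trace T = 0"
    by (simp add: trace_def sum_3 T t1_def t2_def t3_def diag1_def diag2_def diag3_def o2 field_simps)
  have TT: "T ** T = std_adjoint T" and T3: "T ** T ** T = mat 1"
    using cube_eq_one_if_trace_zero[OF TSU trT] by auto
  show "T ** T ** T = mat 1" by (rule T3)
  have e: "(cnj omega)\<^sup>2 + cnj omega + 1 = 0" using omega(2,4) by simp
  have e2: "(cnj omega)\<^sup>2 = - 1 - cnj omega" using omega(2) o2 by simp
  have M: "rot3 ** T \<in> SU std_form" using rot3_SU TSU by (rule SU_mult)
  have d: "(rot3 ** T)$1$1 = z / 3 + cnj w / 3"
    "(rot3 ** T)$2$2 = z / 3 + cnj omega * (cnj w / 3)"
    "(rot3 ** T)$3$3 = z / 3 + (cnj omega)\<^sup>2 * (cnj w / 3)"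
    unfolding matrix_matrix_mult_def using o1
    by (simp_all add: rot3_def sum_3 T t1_def t2_def t3_def diag1_def diag2_def diag3_def e2 o2
        field_simps; algebra)+
  show "parabolic std_form (rot3 ** T)"
    using l n(3) by (intro parabolic_if_equilateral_diagonal(1)[OF M l(1) _ d e]) simp_all
  have N: "rot3 ** (T ** T) \<in> SU std_form" using rot3_SU TSU by (intro SU_mult)
  have d: "(rot3 ** (T ** T))$1$1 = w / 3 + cnj z / 3"
    "(rot3 ** (T ** T))$2$2 = w / 3 + cnj omega * (cnj z / 3)"
    "(rot3 ** (T ** T))$3$3 = w / 3 + (cnj omega)\<^sup>2 * (cnj z / 3)"
    unfolding TT unfolding matrix_matrix_mult_def using o1
    by (simp_all add: std_adjoint_def rot3_def sum_3 T t1_def t2_def t3_def diag1_def diag2_def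
        diag3_def e2 o2 field_simps; algebra)+
  show "parabolic std_form ((rot3 ** (T ** T)) ** (rot3 ** (T ** T)) ** (rot3 ** (T ** T)))"
    using n l(3) by (intro parabolic_if_equilateral_diagonal(2)[OF N n(1) _ d e]) simp_all
  let ?C = "rot3 ** T ** (rot3 ** rot3) ** (T ** T)"
  have C: "?C \<in> SU std_form" using rot3_SU TSU by (intro SU_mult)
  \<comment> \<open>All \<open>|T\<^sub>i\<^sub>j|\<^sup>2\<close> follow from the two off-diagonal ones that are explicit, since rows and columns have
    norm \<open>-1\<close> or \<open>1\<close>.\<close>
  have row: "(T ** std_adjoint T) $ i $ i = 1" and col: "(std_adjoint T ** T) $ i $ i = 1" for i
    using T3 unfolding TT[symmetric] by (simp_all add: matrix_mul_assoc mat_def)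
  have y12: "T$1$2 * cnj (T$1$2) = - of_real k - of_real n3"
    and y23: "T$2$3 * cnj (T$2$3) = of_real k + of_real n1"
    using T by simp_all
  have nn: "t1 * cnj t1 = of_real n1" "t2 * cnj t2 = of_real n2" "t3 * cnj t3 = of_real n3"
    unfolding n1_def n2_def n3_def complex_norm_square by simp_all
  have y13: "T$1$3 * cnj (T$1$3) = of_real n1 + of_real k + of_real n3 - 1"
    using row[of 1] y12 nn by (simp add: matrix_matrix_mult_def std_adjoint_def sum_3 T algebra_simps)
  have y21: "T$2$1 * cnj (T$2$1) = of_real n2 + of_real k + of_real n1 - 1"
    using row[of 2] y23 nn by (simp add: matrix_matrix_mult_def std_adjoint_def sum_3 T algebra_simps)
  have y31: "T$3$1 * cnj (T$3$1) = - of_real n2 - of_real k"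
    using col[of 1] y21 nn
    by (simp add: matrix_matrix_mult_def std_adjoint_def sum_3 T algebra_simps) algebra
  have y32: "T$3$2 * cnj (T$3$2) = 1 - of_real n2 - of_real k - of_real n3"
    using col[of 2] y12 nn by (simp add: matrix_matrix_mult_def std_adjoint_def sum_3 T algebra_simps)
  let ?c = "commutator_trace z w k" and ?o = omega and ?p = "cnj omega"
  have Cii: "?C$1$1 = T$1$1 * cnj (T$1$1) - ?p * (T$1$2 * cnj (T$1$2)) - ?o * (T$1$3 * cnj (T$1$3))"
    "?C$2$2 = ?o * (- (T$2$1 * cnj (T$2$1)) + ?p * (T$2$2 * cnj (T$2$2)) + ?o * (T$2$3 * cnj (T$2$3)))"
    "?C$3$3 = ?p * (- (T$3$1 * cnj (T$3$1)) + ?p * (T$3$2 * cnj (T$3$2)) + ?o * (T$3$3 * cnj (T$3$3)))"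
    unfolding TT rot3_square unfolding matrix_matrix_mult_def
    by (simp_all add: rot3_def std_adjoint_def sum_3 algebra_simps)
  have c: "?c = 3 * (cnj omega * of_real k + omega * (1 - of_real s / 3 - of_real k))"
    unfolding commutator_trace_def s_def[symmetric] by simp
  have d: "?C$1$1 = ?c / 3 + cnj W / 3" "?C$2$2 = ?c / 3 + cnj omega * (cnj W / 3)"
    "?C$3$3 = ?c / 3 + (cnj omega)\<^sup>2 * (cnj W / 3)"
    unfolding Cii y12 y13 y21 y23 y31 y32 T nn c Nn e2 o2 using o1 by (simp_all add: field_simps; algebra)+
  have W: "cnj W / 3 \<noteq> 0" using l(3) n(3) by (simp add: W_def)
  show "parabolic std_form ?C"
    by (rule parabolic_if_equilateral_diagonal(1)[OF C m(1) _ d e W]) (simp add: m(2))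
  show "trace ?C = ?c"
    using trace_equilateral[OF d e] by simp
qed

section \<open>The one-parameter family of traces\<close>

text \<open>The trace of a matrix with eigenvalues \<open>l, l, l\<^sup>-\<^sup>2\<close>, where \<open>l = cis x\<close>; the curve is Steiner's deltoid.\<close>
definition deltoid :: "real \<Rightarrow> complex" where
  "deltoid x = 2 * cis x + (cnj (cis x))\<^sup>2"

lemma Re_deltoid: "Re (deltoid x) = 2 * cos x + 2 * (cos x)\<^sup>2 - 1"
  using sin_squared_eq[of x] by (simp add: deltoid_def power2_eq_square)

lemma Im_deltoid: "Im (deltoid x) = 2 * sin x * (1 - cos x)"
  by (simp add: deltoid_def power2_eq_square algebra_simps)

lemma deltoid_minus: "deltoid (- x) = cnj (deltoid x)"
  by (simp add: deltoid_def cis_cnj)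

lemma cmod_deltoid: "(cmod (deltoid x))\<^sup>2 = 5 + 4 * cos (3 * x)"
proof -
  have "(cmod (deltoid x))\<^sup>2 = (Re (deltoid x))\<^sup>2 + (Im (deltoid x))\<^sup>2" by (rule cmod_power2)
  also have "\<dots> = 5 + 4 * (4 * cos x ^ 3 - 3 * cos x)"
    unfolding Re_deltoid Im_deltoid using sin_squared_eq[of x] by algebra
  finally show ?thesis by (simp add: cos_treble_cos)
qed

text \<open>The polynomial equation of the deltoid. It eliminates the arguments of \<open>z\<close> and \<open>w\<close> from the trace
relation, which then involves only their moduli.\<close>
lemma Re_deltoid_cube:
  "8 * Re (deltoid x ^ 3) = (cmod (deltoid x))\<^sup>2 ^ 2 + 18 * (cmod (deltoid x))\<^sup>2 - 27"
proof -
  have "Re (deltoid x ^ 3) = Re (deltoid x) * ((Re (deltoid x))\<^sup>2 - 3 * (Im (deltoid x))\<^sup>2)"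
    by (simp add: power3_eq_cube power2_eq_square algebra_simps)
  moreover have "(cmod (deltoid x))\<^sup>2 = (Re (deltoid x))\<^sup>2 + (Im (deltoid x))\<^sup>2" by (rule cmod_power2)
  ultimately show ?thesis
    unfolding Re_deltoid Im_deltoid using sin_squared_eq[of x] by algebra
qed

lemma deltoid_arccos:
  assumes "-1 \<le> y" "y \<le> 1"
  shows "(cmod (deltoid (arccos y / 3)))\<^sup>2 = 5 + 4 * y"
  using assms by (simp add: cmod_deltoid cos_arccos)

lemma deltoid_first_quadrant:
  assumes "-1 \<le> y" "y \<le> 1"
  shows "Re (deltoid (arccos y / 3)) > 0" "Im (deltoid (arccos y / 3)) \<ge> 0"
proof -
  let ?x = "arccos y / 3"
  have x: "0 \<le> ?x" "?x \<le> pi / 3" using arccos_lbound[OF assms] arccos_ubound[OF assms] by auto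
  then have "cos (pi / 3) \<le> cos ?x" by (intro cos_monotone_0_pi_le) auto
  then have c: "1 / 2 \<le> cos ?x" by (simp add: cos_60)
  then have "(1 / 2)\<^sup>2 \<le> (cos ?x)\<^sup>2" by (intro power_mono) auto
  then show "Re (deltoid ?x) > 0" using c by (simp add: Re_deltoid power2_eq_square)
  have "0 \<le> sin ?x" using x by (intro sin_ge_zero) auto
  then show "Im (deltoid ?x) \<ge> 0" by (simp add: Im_deltoid)
qed

text \<open>Already \<open>2 Re (deltoid x) + 3 = (1 + 2 cos x)\<^sup>2\<close> is injective where the cosine is non-negative.\<close>
lemma deltoid_inj:
  assumes "x \<in> {0..1}" "y \<in> {0..1}" "deltoid x = deltoid y"
  shows "x = y"
proof -
  have pi: "(1::real) < pi / 2" using pi_gt3 by simp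
  have "(1 + 2 * cos x)\<^sup>2 = (1 + 2 * cos y)\<^sup>2"
    using arg_cong[OF assms(3), of Re] unfolding Re_deltoid
    by (simp add: power2_eq_square algebra_simps)
  moreover have "0 \<le> cos x" "0 \<le> cos y"
    using assms(1,2) pi by (auto intro!: cos_ge_zero)
  ultimately have "cos x = cos y" by (simp add: power2_eq_iff)
  moreover have "0 \<le> x" "x \<le> pi" "0 \<le> y" "y \<le> pi" using assms(1,2) pi by auto
  ultimately show ?thesis using cos_inj_pi by blast
qed

text \<open>With \<open>c = deltoid x\<close>, the sum \<^term>\<open>norm_sum x\<close> is \<open>2 Re c + 3\<close> and the product \<open>norm_prod x\<close> below is
\<open>27/2 + 2 (Im c)\<^sup>2\<close>. Thus \<open>|z|\<^sup>2\<close> and \<open>|w|\<^sup>2\<close> are the roots of a quadratic equation with discriminant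
\<open>discrim x\<close>, and \<open>cos_z x\<close>, \<open>cos_w x\<close> are the cosines of three times the angles that give these
moduli on the deltoid.\<close>
definition norm_sum :: "real \<Rightarrow> real" where
  "norm_sum x = (1 + 2 * cos x)\<^sup>2"

definition norm_prod :: "real \<Rightarrow> real" where
  "norm_prod x = 27 / 2 + 8 * (sin x)\<^sup>2 * (1 - cos x)\<^sup>2"

definition discrim :: "real \<Rightarrow> real" where
  "discrim x = (norm_sum x)\<^sup>2 - 4 * norm_prod x"

definition cos_z :: "real \<Rightarrow> real" where
  "cos_z x = ((norm_sum x + sqrt (discrim x)) / 2 - 5) / 4"

definition cos_w :: "real \<Rightarrow> real" where
  "cos_w x = ((norm_sum x - sqrt (discrim x)) / 2 - 5) / 4"

definition tr_z :: "real \<Rightarrow> complex" where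
  "tr_z x = deltoid (arccos (cos_z x) / 3)"

text \<open>The opposite sign of the angle places \<open>z\<close> and the conjugate of \<open>w\<close> in the same quadrant, so \<open>z w\<close> has positive real
part; this selects which diagonal entry of the invariant form is negative.\<close>
definition tr_w :: "real \<Rightarrow> complex" where
  "tr_w x = deltoid (- (arccos (cos_w x) / 3))"

text \<open>The root \<open>k\<close> of the trace relation for which the commutator trace is \<open>deltoid x\<close> and not its conjugate.\<close>
definition shift :: "real \<Rightarrow> real" where
  "shift x = 1 / 2 - norm_sum x / 6 - Im (deltoid x) / (3 * sqrt 3)"

text \<open>The three inequalities on \<open>k + |t\<^sub>i|\<^sup>2\<close> say that the form preserved by \<open>S\<close> and \<open>T\<close> can be scaled to \<^const>\<open>std_form\<close>.
All inequalities are strict, so they persist near a point where they hold.\<close>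
definition admissible :: "real \<Rightarrow> bool" where
  "admissible x \<longleftrightarrow> discrim x > 0 \<and> -1 < cos_z x \<and> cos_z x < 1 \<and> -1 < cos_w x \<and> cos_w x < 1 \<and>
     shift x + (cmod (diag1 (tr_z x) (tr_w x)))\<^sup>2 > 0 \<and>
     shift x + (cmod (diag2 (tr_z x) (tr_w x)))\<^sup>2 < 0 \<and>
     shift x + (cmod (diag3 (tr_z x) (tr_w x)))\<^sup>2 < 0"

lemma trace_norms:
  assumes "discrim x \<ge> 0" "-1 \<le> cos_z x" "cos_z x \<le> 1" "-1 \<le> cos_w x" "cos_w x \<le> 1"
  shows "(cmod (tr_z x))\<^sup>2 + (cmod (tr_w x))\<^sup>2 = norm_sum x"
    and "(cmod (tr_z x))\<^sup>2 * (cmod (tr_w x))\<^sup>2 = norm_prod x"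
proof -
  have z: "(cmod (tr_z x))\<^sup>2 = (norm_sum x + sqrt (discrim x)) / 2"
    unfolding tr_z_def deltoid_arccos[OF assms(2,3)] by (simp add: cos_z_def field_simps)
  have w: "(cmod (tr_w x))\<^sup>2 = (norm_sum x - sqrt (discrim x)) / 2"
    unfolding tr_w_def deltoid_minus complex_mod_cnj deltoid_arccos[OF assms(4,5)]
    by (simp add: cos_w_def field_simps)
  show "(cmod (tr_z x))\<^sup>2 + (cmod (tr_w x))\<^sup>2 = norm_sum x" unfolding z w by (simp add: field_simps)
  have "(sqrt (discrim x))\<^sup>2 = (norm_sum x)\<^sup>2 - 4 * norm_prod x"
    using assms(1) by (simp add: discrim_def)
  then show "(cmod (tr_z x))\<^sup>2 * (cmod (tr_w x))\<^sup>2 = norm_prod x"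
    unfolding z w by (simp add: field_simps power2_eq_square)
qed

text \<open>After elimination of the cubes by \<open>Re_deltoid_cube\<close>, the trace relation is equivalent to
\<open>2 |z|\<^sup>2|w|\<^sup>2 = 27 + 4 (Im c)\<^sup>2\<close>, which is how \<^const>\<open>norm_prod\<close> was chosen.\<close>
lemma trace_relation_family:
  assumes "discrim x \<ge> 0" "-1 \<le> cos_z x" "cos_z x \<le> 1" "-1 \<le> cos_w x" "cos_w x \<le> 1"
  shows "trace_relation (tr_z x) (tr_w x) (shift x)"
proof -
  define s p where "s = norm_sum x" and "p = norm_prod x"
  define a b where "a = (cmod (tr_z x))\<^sup>2" and "b = (cmod (tr_w x))\<^sup>2"
  define i where "i = Im (deltoid x)"
  have ab: "a + b = s" "a * b = p"
    using trace_norms[OF assms] unfolding a_def b_def s_def p_def by auto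
  have "8 * Re (tr_z x ^ 3) = a ^ 2 + 18 * a - 27" "8 * Re (tr_w x ^ 3) = b ^ 2 + 18 * b - 27"
    unfolding tr_z_def tr_w_def a_def b_def by (rule Re_deltoid_cube)+
  then have R: "8 * Re (tr_z x ^ 3 + tr_w x ^ 3) = s ^ 2 - 2 * p + 18 * s - 54"
    unfolding ab[symmetric] plus_complex.sel by algebra
  have p: "2 * p = 27 + 4 * i\<^sup>2"
    by (simp add: p_def norm_prod_def i_def Im_deltoid power_mult_distrib)
  define d where "d = i / (3 * sqrt 3)"
  have d: "d\<^sup>2 = i\<^sup>2 / 27" by (simp add: d_def power_divide power_mult_distrib)
  have "(shift x)\<^sup>2 + shift x * (s / 3 - 1) = d\<^sup>2 - (1 / 2 - s / 6)\<^sup>2"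
    unfolding shift_def s_def[symmetric] i_def[symmetric] d_def[symmetric]
    by (simp add: power2_eq_square algebra_simps)
  then show ?thesis
    unfolding trace_relation_def a_def[symmetric] b_def[symmetric] ab
    using R p d by (simp add: power2_eq_square field_simps)
qed

lemma commutator_trace_family:
  assumes "discrim x \<ge> 0" "-1 \<le> cos_z x" "cos_z x \<le> 1" "-1 \<le> cos_w x" "cos_w x \<le> 1"
  shows "commutator_trace (tr_z x) (tr_w x) (shift x) = 2 * cis x + (cnj (cis x))\<^sup>2"
proof -
  have c: "commutator_trace (tr_z x) (tr_w x) (shift x) = 3 * (cnj omega * of_real (shift x)
      + omega * of_real (1 - norm_sum x / 3 - shift x))"
    unfolding commutator_trace_def trace_norms[OF assms] ..
  have "Re (commutator_trace (tr_z x) (tr_w x) (shift x)) = (norm_sum x - 3) / 2"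
    unfolding c by (simp add: omega_def field_simps)
  also have "\<dots> = Re (deltoid x)"
    unfolding Re_deltoid norm_sum_def by (simp add: power2_eq_square field_simps)
  finally have "Re (commutator_trace (tr_z x) (tr_w x) (shift x)) = Re (deltoid x)" .
  moreover have "Im (commutator_trace (tr_z x) (tr_w x) (shift x)) = Im (deltoid x)"
    unfolding c by (simp add: omega_def shift_def field_simps)
  ultimately show ?thesis unfolding complex_eq_iff deltoid_def by simp
qed

lemma cmod_deltoid_pos: "cmod (deltoid x) > 0"
proof -
  have "0 < (cmod (deltoid x))\<^sup>2" unfolding cmod_deltoid using cos_ge_minus_one[of "3 * x"] by linarith
  then show ?thesis by simp
qed

text \<open>At \<open>x = 0\<close> we have \<open>c = 3\<close>, \<open>k = -1\<close> and \<open>|z|\<^sup>2, |w|\<^sup>2 = (9 \<plusminus> sqrt 27)/2\<close>. The three factors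
\<open>k + |t\<^sub>i|\<^sup>2\<close> add up to zero, and their product is \<open>|q|\<^sup>2\<close> with \<open>q = (z\<^sup>3 + cnj w\<^sup>3)/27 - 1\<close>. It is positive
because \<open>|z|\<^sup>3 + |w|\<^sup>3 < 3 (|z|\<^sup>2 + |w|\<^sup>2) = 27\<close>. The first factor is \<open>2 Re (z w)/9 > 0\<close>, so the
other two have positive product and negative sum.\<close>
lemma admissible_0: "admissible 0"
proof -
  define r where "r = sqrt (27 :: real)"
  have r: "5 < r" "r < 6"
    unfolding r_def by (rule real_less_rsqrt, simp) (rule real_less_lsqrt, simp_all)
  have s: "norm_sum 0 = 9" and pr: "norm_prod 0 = 27 / 2" and sh: "shift 0 = -1"
    by (simp_all add: norm_sum_def norm_prod_def shift_def Im_deltoid)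
  have d: "discrim 0 = 27" by (simp add: discrim_def s pr)
  have cz: "cos_z 0 = (r - 1) / 8" and cw: "cos_w 0 = (- r - 1) / 8"
    by (simp_all add: cos_z_def cos_w_def s d r_def field_simps)
  have bounds: "-1 < cos_z 0" "cos_z 0 < 1" "-1 < cos_w 0" "cos_w 0 < 1"
    using r by (simp_all add: cz cw)
  have weak: "discrim 0 \<ge> 0" "-1 \<le> cos_z 0" "cos_z 0 \<le> 1" "-1 \<le> cos_w 0" "cos_w 0 \<le> 1"
    using bounds d by auto
  let ?z = "tr_z 0" and ?w = "tr_w 0"
  note norms = trace_norms[OF weak, unfolded s pr]
  define n1 n2 n3 where "n1 = (cmod (diag1 ?z ?w))\<^sup>2" and "n2 = (cmod (diag2 ?z ?w))\<^sup>2"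
    and "n3 = (cmod (diag3 ?z ?w))\<^sup>2"
  define q where "q = diag1 ?z ?w * diag2 ?z ?w * diag3 ?z ?w + complex_of_real (-1)"
  have sum: "n1 + n2 + n3 = 3"
    using diag_relations(1)[of ?z ?w] by (simp add: n1_def n2_def n3_def norms)
  have "q \<noteq> 0"
  proof
    have small: "cmod u ^ 3 < 3 * (cmod u)\<^sup>2" if "u \<noteq> 0" "(cmod u)\<^sup>2 < 9" for u :: complex
    proof -
      have "cmod u < 3" using that(2) by (intro power2_less_imp_less[of _ 3]) simp_all
      then have "cmod u * (cmod u)\<^sup>2 < 3 * (cmod u)\<^sup>2" using that(1) by (intro mult_strict_right_mono) simp_all
      then show ?thesis by (simp add: power3_eq_cube power2_eq_square)
    qed
    have nz: "?z \<noteq> 0" "?w \<noteq> 0" using cmod_deltoid_pos by (auto simp: tr_z_def tr_w_def)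
    then have "(cmod ?z)\<^sup>2 > 0" "(cmod ?w)\<^sup>2 > 0" by simp_all
    then have "(cmod ?z)\<^sup>2 < 9" "(cmod ?w)\<^sup>2 < 9" using norms(1) by linarith+
    then have "cmod ?z ^ 3 + cmod ?w ^ 3 < 3 * ((cmod ?z)\<^sup>2 + (cmod ?w)\<^sup>2)"
      using small[OF nz(1)] small[OF nz(2)] norms(1) by simp
    then have lt: "cmod ?z ^ 3 + cmod ?w ^ 3 < 27" by (simp add: norms(1))
    assume "q = 0"
    then have "?z ^ 3 + cnj ?w ^ 3 = 27" by (simp add: q_def diag_product)
    then have "27 \<le> cmod (?z ^ 3) + cmod (cnj ?w ^ 3)"
      using norm_triangle_ineq[of "?z ^ 3" "cnj ?w ^ 3"] by simp
    then show False using lt by (simp add: norm_power)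
  qed
  then have "0 < (cmod q)\<^sup>2" by simp
  also have "(cmod q)\<^sup>2 = (-1 + n1) * (-1 + n2) * (-1 + n3)"
    unfolding q_def n1_def n2_def n3_def
    by (rule order_three_quadratic(2), rule diag_quadratic)
      (use trace_relation_family[OF weak] sh in simp)
  finally have prod: "0 < (n1 - 1) * ((n2 - 1) * (n3 - 1))" by (simp add: mult.assoc)
  have "0 < Re (?z * ?w)"
  proof -
    have "Re ?z > 0" "Im ?z \<ge> 0" "Re ?w > 0" "Im ?w \<le> 0"
      using deltoid_first_quadrant[of "cos_z 0"] deltoid_first_quadrant[of "cos_w 0"] weak
      by (simp_all add: tr_z_def tr_w_def deltoid_minus)
    then have "0 < Re ?z * Re ?w" "Im ?z * Im ?w \<le> 0" by (simp_all add: mult_nonneg_nonpos)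
    then show ?thesis by simp
  qed
  moreover have "n1 = 1 + 2 * Re (?z * ?w) / 9"
  proof -
    have "complex_of_real n1 = (?z * cnj ?z + ?w * cnj ?w + ?z * ?w + cnj (?z * ?w)) / 9"
      unfolding n1_def by (rule diag_norms(1))
    also have "?z * cnj ?z + ?w * cnj ?w = complex_of_real 9"
      unfolding norms(1)[symmetric] of_real_add complex_norm_square ..
    also have "(complex_of_real 9 + ?z * ?w + cnj (?z * ?w)) / 9 = complex_of_real (1 + 2 * Re (?z * ?w) / 9)"
      using complex_add_cnj[of "?z * ?w"] by (simp add: complex_eq_iff)
    finally show ?thesis by (simp only: of_real_eq_iff)
  qed
  ultimately have n1: "n1 > 1" by simp
  then have "0 < (n2 - 1) * (n3 - 1)" using prod by (simp add: zero_less_mult_iff)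
  then have "n2 < 1" "n3 < 1" using n1 sum by (auto simp: zero_less_mult_iff)
  then show ?thesis
    using n1 bounds d by (simp add: admissible_def sh n1_def n2_def n3_def)
qed

lemma eventually_admissible: "eventually admissible (nhds 0)"
proof -
  have s: "isCont norm_sum 0" and p: "isCont norm_prod 0"
    unfolding norm_sum_def[abs_def] norm_prod_def[abs_def] by (intro continuous_intros)+
  have d: "isCont discrim 0"
    unfolding discrim_def[abs_def] by (intro continuous_intros s p)
  have c: "isCont cos_z 0" "isCont cos_w 0"
    unfolding cos_z_def[abs_def] cos_w_def[abs_def] by (intro continuous_intros s d; simp)+
  have deltoid: "isCont deltoid y" for y
    unfolding deltoid_def[abs_def] cis_conv_exp by (intro continuous_intros)
  have 0: "discrim 0 > 0" "-1 < cos_z 0" "cos_z 0 < 1" "-1 < cos_w 0" "cos_w 0 < 1"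
    "shift 0 + (cmod (diag1 (tr_z 0) (tr_w 0)))\<^sup>2 > 0"
    "shift 0 + (cmod (diag2 (tr_z 0) (tr_w 0)))\<^sup>2 < 0"
    "shift 0 + (cmod (diag3 (tr_z 0) (tr_w 0)))\<^sup>2 < 0"
    using admissible_0 by (simp_all add: admissible_def)
  have ac: "isCont (\<lambda>x. arccos (cos_z x)) 0" "isCont (\<lambda>x. arccos (cos_w x)) 0"
    using isCont_o2[OF c(1) isCont_arccos] isCont_o2[OF c(2) isCont_arccos] 0 by auto
  have z: "isCont tr_z 0" "isCont tr_w 0"
    unfolding tr_z_def[abs_def] tr_w_def[abs_def]
    by (rule isCont_o2[OF _ deltoid], intro continuous_intros ac; simp)+
  have sh: "isCont shift 0"
    unfolding shift_def[abs_def] Im_deltoid by (intro continuous_intros s) simp_all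
  have n: "isCont (\<lambda>x. shift x + (cmod (diag1 (tr_z x) (tr_w x)))\<^sup>2) 0"
    "isCont (\<lambda>x. shift x + (cmod (diag2 (tr_z x) (tr_w x)))\<^sup>2) 0"
    "isCont (\<lambda>x. shift x + (cmod (diag3 (tr_z x) (tr_w x)))\<^sup>2) 0"
    unfolding diag1_def diag2_def diag3_def by (intro continuous_intros sh z; simp)+
  have lower: "eventually (\<lambda>x. a < f x) (nhds 0)" if "isCont f 0" "a < f 0"
    for a and f :: "real \<Rightarrow> real"
    using that order_tendstoD(1)[of f "f 0" "nhds 0"]
    by (simp add: continuous_at tendsto_at_iff_tendsto_nhds)
  have upper: "eventually (\<lambda>x. f x < a) (nhds 0)" if "isCont f 0" "f 0 < a"
    for a and f :: "real \<Rightarrow> real"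
    using that order_tendstoD(2)[of f "f 0" "nhds 0"]
    by (simp add: continuous_at tendsto_at_iff_tendsto_nhds)
  show ?thesis
    unfolding admissible_def[abs_def]
    by (intro eventually_conj lower upper d c n 0)
qed

lemma continuous_on_vector_3:
  fixes f g h :: "'b::topological_space \<Rightarrow> 'a::real_normed_vector"
  assumes "continuous_on S f" "continuous_on S g" "continuous_on S h"
  shows "continuous_on S (\<lambda>x. vector [f x, g x, h x] :: 'a^3)"
proof -
  have eq: "(vector [f x, g x, h x] :: 'a^3)
      = (\<chi> i. if i = 1 then f x else if i = 2 then g x else h x)" for x
    by (simp add: vec_eq_iff forall_3)
  show ?thesis
    unfolding eq
  proof (rule continuous_on_vec_lambda)
    fix i :: 3
    show "continuous_on S (\<lambda>x. if i = 1 then f x else if i = 2 then g x else h x)"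
      using assms by (cases "i = 1"; cases "i = 2") simp_all
  qed
qed

lemma continuous_on_matrix_mult:
  fixes f g :: "'b::topological_space \<Rightarrow> complex^3^3"
  assumes "continuous_on S f" "continuous_on S g"
  shows "continuous_on S (\<lambda>x. f x ** g x)"
  unfolding matrix_matrix_mult_def by (intro continuous_intros assms)

lemma continuous_on_family:
  assumes adm: "\<And>x. x \<in> S \<Longrightarrow> admissible x"
  shows "continuous_on S (\<lambda>x. order_three_elt (diag1 (tr_z x) (tr_w x)) (diag2 (tr_z x) (tr_w x))
      (diag3 (tr_z x) (tr_w x)) (shift x))"
proof -
  note a = adm[unfolded admissible_def]
  have s: "continuous_on S norm_sum" and p: "continuous_on S norm_prod"
    unfolding norm_sum_def[abs_def] norm_prod_def[abs_def] by (intro continuous_intros)+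
  have d: "continuous_on S discrim"
    unfolding discrim_def[abs_def] by (intro continuous_intros s p)
  have c: "continuous_on S cos_z" "continuous_on S cos_w"
    unfolding cos_z_def[abs_def] cos_w_def[abs_def] by (intro continuous_intros s d; simp)+
  have z: "continuous_on S tr_z" "continuous_on S tr_w"
    unfolding tr_z_def[abs_def] tr_w_def[abs_def] deltoid_def
    by (intro continuous_intros c; use a in \<open>auto intro: less_imp_le\<close>)+
  have sh: "continuous_on S shift"
    unfolding shift_def[abs_def] Im_deltoid by (intro continuous_intros s) simp_all
  have t: "continuous_on S (\<lambda>x. diag1 (tr_z x) (tr_w x))" "continuous_on S (\<lambda>x. diag2 (tr_z x) (tr_w x))"
    "continuous_on S (\<lambda>x. diag3 (tr_z x) (tr_w x))"
    unfolding diag1_def diag2_def diag3_def by (intro continuous_intros z; simp)+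
  have q: "diag1 (tr_z x) (tr_w x) * diag2 (tr_z x) (tr_w x) * diag3 (tr_z x) (tr_w x)
      + complex_of_real (shift x) \<noteq> 0" (is "?q \<noteq> 0") if "x \<in> S" for x
  proof -
    have "trace_relation (tr_z x) (tr_w x) (shift x)"
      by (rule trace_relation_family) (use a[OF that] in auto)
    from order_three_quadratic(2)[OF diag_quadratic[OF this]]
    have "(cmod ?q)\<^sup>2 \<noteq> 0" using a[OF that] by simp
    then show ?thesis by simp
  qed
  have r: "sqrt (- (shift x + (cmod (diag3 (tr_z x) (tr_w x)))\<^sup>2)) \<noteq> 0"
    "sqrt (shift x + (cmod (diag1 (tr_z x) (tr_w x)))\<^sup>2) \<noteq> 0" if "x \<in> S" for x
    using a[OF that] by simp_all
  show ?thesis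
    unfolding order_three_elt_def Let_def
    by (intro continuous_on_vector_3 continuous_intros t sh) (use q r in auto)
qed

section \<open>Arbitrary forms of signature (2,1)\<close>

text \<open>Normalizing the orthogonal basis in the definition of the signature gives the columns of an isometry.\<close>
lemma signature_2_1_standard:
  assumes "hermitian_signature_2_1 H"
  obtains U V where "isometric_inverses std_form H U V"
proof -
  have H: "H $ i $ j = cnj (H $ j $ i)" for i j
    using assms unfolding hermitian_signature_2_1_def by blast
  obtain u v w where uvw: "herm H u v = 0" "herm H u w = 0" "herm H v w = 0"
    "Re (herm H u u) > 0" "Re (herm H v v) > 0" "Re (herm H w w) < 0"
    using assms unfolding hermitian_signature_2_1_def by blast
  have sym: "herm H y x = cnj (herm H x y)" for x y
  proof -
    have "cnj (herm H x y) = (\<Sum>i\<in>UNIV. \<Sum>j\<in>UNIV. y $ i * H $ j $ i * cnj (x $ j))"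
      unfolding herm_def by (simp add: H[symmetric])
    also have "\<dots> = herm H y x"
      unfolding herm_def by (subst sum.swap) (simp add: mult_ac)
    finally show ?thesis ..
  qed
  have real: "herm H x x = complex_of_real (Re (herm H x x))" for x
    using sym[of x x] by (simp add: complex_eq_iff)
  define unit where "unit x = complex_of_real (1 / sqrt \<bar>Re (herm H x x)\<bar>) *s x" for x
  have unit: "herm H (unit x) (unit x) = sgn (Re (herm H x x))" if "Re (herm H x x) \<noteq> 0" for x
  proof -
    define h where "h = Re (herm H x x)"
    have hx: "herm H x x = complex_of_real h" unfolding h_def by (rule real)
    have "herm H (unit x) (unit x) = complex_of_real (h / (sqrt \<bar>h\<bar> * sqrt \<bar>h\<bar>))"
      unfolding unit_def h_def[symmetric] herm_scale_left herm_scale_right hx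
      by (simp flip: of_real_mult)
    also have "sqrt \<bar>h\<bar> * sqrt \<bar>h\<bar> = \<bar>h\<bar>" by simp
    finally show ?thesis using that unfolding h_def[symmetric] by (simp add: sgn_if)
  qed
  define e1 e2 e3 where "e1 = unit w" and "e2 = unit u" and "e3 = unit v"
  have orth: "herm H (unit x) (unit y) = 0" if "herm H x y = 0" for x y
    using that by (simp add: unit_def herm_linear)
  have e: "herm H e1 e1 = -1" "herm H e2 e2 = 1" "herm H e3 e3 = 1"
    "herm H e1 e2 = 0" "herm H e1 e3 = 0" "herm H e2 e1 = 0" "herm H e3 e1 = 0"
    "herm H e2 e3 = 0" "herm H e3 e2 = 0"
    unfolding e1_def e2_def e3_def using uvw sym[of w u] sym[of w v] sym[of v u]
    by (auto intro!: orth simp: unit)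
  define U :: "complex^3^3" where "U = (\<chi> i j. if j = 1 then e1 $ i else if j = 2 then e2 $ i else e3 $ i)"
  have Ux: "U *v x = x $ 1 *s e1 + (x $ 2 *s e2 + x $ 3 *s e3)" for x
    by (simp add: vec_eq_iff matrix_vector_mult_def U_def sum_3 mult.commute)
  have iso: "herm H (U *v x) (U *v y) = herm std_form x y" for x y
    unfolding Ux herm_linear e by (simp add: herm_std_form algebra_simps)
  have "x = 0" if "U *v x = 0" for x
  proof (rule std_form_nondegenerate)
    fix y show "herm std_form x y = 0"
      unfolding iso[symmetric] that by (simp add: herm_def)
  qed
  then obtain V where "V ** U = mat 1" using matrix_left_invertible_ker[of U] by blast
  then have "isometric_inverses std_form H U V"
    using iso by (simp add: isometric_inverses_def matrix_left_right_inverse)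
  then show thesis using that by blast
qed

lemma trace_conj:
  fixes U V X :: "complex^3^3"
  assumes "V ** U = mat 1"
  shows "trace (U ** X ** V) = trace X"
proof -
  have "trace (U ** X ** V) = trace (V ** (U ** X))" by (rule trace_mul_sym)
  also have "V ** (U ** X) = X" by (simp add: matrix_mul_assoc assms)
  finally show ?thesis .
qed

text \<open>The word \<open>AB\<^sup>2\<close> contains no inverses and its trace is that of \<open>[S,T]\<close>, which determines the parameter.\<close>
lemma trace_simultaneously_conjugate:
  assumes "simultaneously_conjugate H A B A' B'"
  shows "trace (A' ** (B' ** B')) = trace (A ** (B ** B))"
proof -
  obtain C where C: "C \<in> SU H" "A' = C ** A ** matrix_inv C" "B' = C ** B ** matrix_inv C"
    using assms by (auto simp: simultaneously_conjugate_def)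
  have i: "matrix_inv C ** C = mat 1"
    using SU_isometric_inverses[OF C(1)] by (simp add: isometric_inverses_def)
  have ix: "matrix_inv C ** (C ** X) = X" for X by (simp add: matrix_mul_assoc i)
  have "A' ** (B' ** B') = C ** (A ** (B ** B)) ** matrix_inv C"
    unfolding C by (simp only: matrix_mul_assoc[symmetric] ix)
  then show ?thesis using trace_conj[OF i] by simp
qed

theorem corollary4p8:
  fixes H :: "complex^3^3"
  assumes "hermitian_signature_2_1 H"
  shows "\<exists>(I :: real set) (A :: real \<Rightarrow> complex^3^3) (B :: real \<Rightarrow> complex^3^3).
    is_interval I \<and> (\<exists>s\<in>I. \<exists>t\<in>I. s \<noteq> t) \<and>
    continuous_on I A \<and> continuous_on I B \<and>
    (\<forall>t\<in>I. A t \<in> SU H \<and> B t \<in> SU H \<and>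
       parabolic H (A t) \<and>
       parabolic H (B t) \<and>
       parabolic H (A t ** B t) \<and>
       parabolic H (A t ** matrix_inv (B t)) \<and>
       parabolic H (A t ** (B t ** B t)) \<and>
       parabolic H ((A t ** A t) ** B t) \<and>
       parabolic H (A t ** B t ** matrix_inv (A t) ** matrix_inv (B t))) \<and>
    (\<forall>s\<in>I. \<forall>t\<in>I. s \<noteq> t \<longrightarrow>
       \<not> simultaneously_conjugate H (A s) (B s) (A t) (B t))"
proof -
  obtain U V where iso: "isometric_inverses std_form H U V"
    using signature_2_1_standard[OF assms] .
  have VU: "V ** U = mat 1" and UV: "U ** V = mat 1"
    using iso by (simp_all add: isometric_inverses_def)
  have VUx: "V ** (U ** X) = X" for X by (simp add: matrix_mul_assoc VU)
  obtain d where d: "d > 0" "\<And>x. dist x 0 < d \<Longrightarrow> admissible x"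
    using eventually_admissible by (auto simp: eventually_nhds_metric)
  define r where "r = min (d / 2) 1"
  define I where "I = {0..r}"
  have r: "0 < r" "r \<le> 1" "r < d" using d(1) by (auto simp: r_def)
  have adm: "admissible x" if "x \<in> I" for x
    using that r by (intro d(2)) (auto simp: I_def dist_real_def)
  define T0 where "T0 x = order_three_elt (diag1 (tr_z x) (tr_w x)) (diag2 (tr_z x) (tr_w x))
      (diag3 (tr_z x) (tr_w x)) (shift x)" for x
  define S T where "S = U ** rot3 ** V" and "T x = U ** T0 x ** V" for x
  define A B where "A x = S ** T x" and "B x = T x ** S" for x
  have T: "continuous_on I T"
    unfolding T_def[abs_def] T0_def
    by (intro continuous_on_matrix_mult continuous_on_const continuous_on_family adm)
  have cA: "continuous_on I A" and cB: "continuous_on I B"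
    unfolding A_def[abs_def] B_def[abs_def]
    by (intro continuous_on_matrix_mult continuous_on_const T)+
  have mult: "(U ** X ** V) ** (U ** Y ** V) = U ** (X ** Y) ** V" for X Y
    by (simp only: matrix_mul_assoc[symmetric] VUx)
  have main: "T x \<in> SU H \<and> T x ** T x ** T x = mat 1 \<and> parabolic H (S ** T x) \<and>
      parabolic H ((S ** (T x ** T x)) ** (S ** (T x ** T x)) ** (S ** (T x ** T x))) \<and>
      parabolic H (S ** T x ** (S ** S) ** (T x ** T x)) \<and>
      trace (S ** T x ** (S ** S) ** (T x ** T x)) = deltoid x" if "x \<in> I" for x
  proof -
    have a: "discrim x \<ge> 0" "-1 \<le> cos_z x" "cos_z x \<le> 1" "-1 \<le> cos_w x" "cos_w x \<le> 1"
      and p: "shift x + (cmod (diag1 (tr_z x) (tr_w x)))\<^sup>2 > 0"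
      "shift x + (cmod (diag2 (tr_z x) (tr_w x)))\<^sup>2 < 0"
      "shift x + (cmod (diag3 (tr_z x) (tr_w x)))\<^sup>2 < 0"
      using adm[OF that] by (auto simp: admissible_def)
    have nz: "tr_z x \<noteq> 0" "tr_w x \<noteq> 0"
      using cmod_deltoid_pos by (auto simp: tr_z_def tr_w_def)
    have pair: "T0 x \<in> SU std_form" "T0 x ** T0 x ** T0 x = mat 1"
      "parabolic std_form (rot3 ** T0 x)"
      "parabolic std_form ((rot3 ** (T0 x ** T0 x)) ** (rot3 ** (T0 x ** T0 x)) ** (rot3 ** (T0 x ** T0 x)))"
      "parabolic std_form (rot3 ** T0 x ** (rot3 ** rot3) ** (T0 x ** T0 x))"
      "trace (rot3 ** T0 x ** (rot3 ** rot3) ** (T0 x ** T0 x)) = deltoid x"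
      using order_three_pair[OF norm_cis _ nz(1) norm_cis _ nz(2) norm_cis
          commutator_trace_family[OF a] trace_relation_family[OF a] p]
        commutator_trace_family[OF a]
      unfolding T0_def by (simp_all add: tr_z_def tr_w_def deltoid_def)
    show ?thesis
      unfolding S_def T_def mult trace_conj[OF VU] pair(2)
      using parabolic_transport[OF iso pair(3)] parabolic_transport[OF iso pair(4)]
        parabolic_transport[OF iso pair(5)] pair(6) SU_transport[OF iso pair(1)] UV by simp
  qed
  have S: "S \<in> SU H" unfolding S_def by (rule SU_transport[OF iso rot3_SU])
  have S3: "S ** S ** S = mat 1" unfolding S_def mult rot3_cube using UV by simp
  have nonconj: "\<not> simultaneously_conjugate H (A s) (B s) (A t) (B t)" if "s \<in> I" "t \<in> I" "s \<noteq> t" for s t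
  proof
    assume "simultaneously_conjugate H (A s) (B s) (A t) (B t)"
    then have "trace (A t ** (B t ** B t)) = trace (A s ** (B s ** B s))"
      by (rule trace_simultaneously_conjugate)
    then have "deltoid t = deltoid s"
      using trace_A_B_squared[OF S3] main that(1,2) by (simp add: A_def B_def)
    then show False using deltoid_inj[of t s] that r by (auto simp: I_def)
  qed
  have two: "\<exists>s\<in>I. \<exists>t\<in>I. s \<noteq> t"
    using r by (intro bexI[of _ 0] bexI[of _ r]) (auto simp: I_def)
  have interval: "is_interval I" by (simp add: I_def is_interval_cc)
  have words: "\<forall>t\<in>I. A t \<in> SU H \<and> B t \<in> SU H \<and>
       parabolic H (A t) \<and> parabolic H (B t) \<and> parabolic H (A t ** B t) \<and>
       parabolic H (A t ** matrix_inv (B t)) \<and> parabolic H (A t ** (B t ** B t)) \<and>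
       parabolic H ((A t ** A t) ** B t) \<and>
       parabolic H (A t ** B t ** matrix_inv (A t) ** matrix_inv (B t))"
  proof
    fix t assume "t \<in> I"
    from main[OF this] S S3 parabolic_words[of S H "T t"]
    show "A t \<in> SU H \<and> B t \<in> SU H \<and>
       parabolic H (A t) \<and> parabolic H (B t) \<and> parabolic H (A t ** B t) \<and>
       parabolic H (A t ** matrix_inv (B t)) \<and> parabolic H (A t ** (B t ** B t)) \<and>
       parabolic H ((A t ** A t) ** B t) \<and>
       parabolic H (A t ** B t ** matrix_inv (A t) ** matrix_inv (B t))"
      unfolding A_def B_def by (auto intro: SU_mult)
  qed
  from nonconj have "\<forall>s\<in>I. \<forall>t\<in>I. s \<noteq> t \<longrightarrow>
       \<not> simultaneously_conjugate H (A s) (B s) (A t) (B t)" by (intro ballI impI)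
  then show ?thesis
    using interval two cA cB words by (intro exI[of _ I] exI[of _ A] exI[of _ B] conjI)
qed

end
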